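(* Assume that: (i) $K$ is a bounded nonnegative function on $\mathbb{R}^d$ with $\int_{\mathbb{R}^d}K(z)\,dz=1$, $\int_{\mathbb{R}^d}z_jK(z)\,dz=0$ for all $j\in\{1,\dots,d\}$, and $\int_{\mathbb{R}^d}\|z\|^2|K(z)|\,dz<\infty$; (ii) $K$ is Hölder-continuous on $\mathbb{R}^d$ and satisfies the covering number condition; (iii) $f$ is twice differentiable on $\mathbb{R}^d$, $\sup_{x\in\mathbb{R}^d}\|\nabla f(x)\|<\infty$ and $\sup_{x\in\mathbb{R}^d}\|D^2f(x)\|<\infty$. Let $C\subset\mathbb{R}^d$ be a nonempty compact set on which $f$ is bounded away from zero, and assume that $$\frac{nh_n^{*d}}{v_n^2\log(1/h_n^* )}\to\infty,\qquad v_nh_n^{*2}\to 0,\qquad \frac{v_n^2h_n^d}{h_n^{*d}}\to\infty .$$ Then, for any $\delta>0$, $$\lim_{n\to\infty}\frac{v_n^2}{nh_n^{*d}}\log\mathbb{P}\left(\exists x\in C,\ f(x)\notin\left[f_n^*(x)-\delta\frac{\sqrt{f_n(x)\kappa}}{v_n}\,;\,f_n^*(x)+\delta\frac{\sqrt{f_n(x)\kappa}}{v_n}\right]\right)=-\frac{\delta^2}{2}.$$ Moreover, the sequence of sets of functions $$D_n=\left\{g:\mathbb{R}^d\to\mathbb{R},\ |g(x)-f_n^*(x)|\leq\delta\frac{\sqrt{f_n(x)\kappa}}{v_n}\ \ \forall x\in C\right\}$$ is an asymptotic almost sure sequence of confidence regions of $f$.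
   Context: Setting: $d\geq 1$ is an integer and $X_1,X_2,\dots$ are independent identically distributed $\mathbb{R}^d$-valued random vectors, defined on a probability space $(\Omega,\mathcal{A},\mathbb{P})$, with bounded probability density $f$. The kernel $K$ is a bounded nonnegative function on $\mathbb{R}^d$ with $\int K=1$ and $\lim_{\|z\|\to\infty}K(z)=0$. $(h_n)$ and $(h_n^* )$ are sequences of positive real numbers with $h_n\to 0$, $h_n^*\to 0$. $(v_n)$ is a positive nonrandom sequence with $v_n\to\infty$. The kernel density estimators are $$f_n(x)=\frac{1}{nh_n^d}\sum_{j=1}^nK\left(\frac{x-X_j}{h_n}\right),\qquad f_n^*(x)=\frac{1}{nh_n^{*d}}\sum_{j=1}^nK\left(\frac{x-X_j}{h_n^*}\right),$$ and $\kappa=\int_{\mathbb{R}^d}K^2(z)\,dz$. Covering number condition: for a probability $Q$ on $\mathbb{R}^d$ and a class $\mathcal{F}\subset\mathcal{L}_2(Q)$, the covering number $N_2(\epsilon,Q,\mathcal{F})$ is the smallest $m$ for which there exist $g_1,\dots,g_m\in\mathcal{L}_2(Q)$ with $\min_{1\leq i\leq m}\|g-g_i\|_{\mathcal{L}_2(Q)}\leq\epsilon$ for all $g\in\mathcal{F}$ ($N_2=\infty$ if no such $m$ exists). For a bounded integrable function $\Lambda$ on $\mathbb{R}^d$ let $\mathcal{F}(\Lambda)=\{z\mapsto\Lambda(\frac{x-z}{h}):\ h>0,\ x\in\mathbb{R}^d\}$. $\Lambda$ satisfies the covering number condition if there exist $A>0$ and $v>0$ such that, for any probability $Q$ on $\mathbb{R}^d$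 and any $\epsilon\in(0,1)$, $N_2(\epsilon\|\Lambda\|_\infty,Q,\mathcal{F}(\Lambda))\leq(A/\epsilon)^v$. A sequence $(D_n)$ of (random) confidence regions of an unknown parameter $\theta$ is an asymptotic almost sure sequence of confidence regions of $\theta$ if there exists $\Omega_0\subset\Omega$ with $\mathbb{P}(\Omega_0)=1$ such that for every $\omega\in\Omega_0$ there is $N(\omega)$ such that $n\geq N(\omega)$ implies $\theta\in D_n(\omega)$. *)

theory Defs
  imports "HOL-Probability.Probability"
begin

text \<open>
  The sample is indexed by \<open>j \<ge> 1\<close>; \<open>xs\<close> is a realisation of the sequence and only
  \<open>xs 1, \<dots>, xs n\<close> enter the estimator.
\<close>

definition kernel_estimator ::
  "(real ^ 'n \<Rightarrow> real) \<Rightarrow> real \<Rightarrow> (nat \<Rightarrow> real ^ 'n) \<Rightarrow> nat \<Rightarrow> real ^ 'n \<Rightarrow> real"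
where
  "kernel_estimator K h xs n x =
     1 / (real n * h ^ CARD('n)) * (\<Sum>j = 1..n. K ((x - xs j) /\<^sub>R h))"

definition kernel_kappa :: "(real ^ 'n \<Rightarrow> real) \<Rightarrow> real" where
  "kernel_kappa K = (LINT z|lborel. (K z)\<^sup>2)"

definition holder_continuous :: "('a::metric_space \<Rightarrow> 'b::metric_space) \<Rightarrow> bool" where
  "holder_continuous g \<longleftrightarrow>
     (\<exists>a L. 0 < a \<and> a \<le> 1 \<and> 0 \<le> L \<and> (\<forall>x y. dist (g x) (g y) \<le> L * dist x y powr a))"

definition L2_functions :: "'a measure \<Rightarrow> ('a \<Rightarrow> real) set" where
  "L2_functions Q = {g \<in> borel_measurable Q. integrable Q (\<lambda>z. (g z)\<^sup>2)}"

definition L2_seminorm :: "'a measure \<Rightarrow> ('a \<Rightarrow> real) \<Rightarrow> real" where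
  "L2_seminorm Q g = sqrt (LINT z|Q. (g z)\<^sup>2)"

text \<open>The infimum of the empty set in \<^typ>\<open>enat\<close> is \<open>\<infinity>\<close>.\<close>

definition covering_number :: "real \<Rightarrow> 'a measure \<Rightarrow> ('a \<Rightarrow> real) set \<Rightarrow> enat" where
  "covering_number \<epsilon> Q F =
     Inf {enat m | m. \<exists>g :: nat \<Rightarrow> 'a \<Rightarrow> real.
       (\<forall>i\<in>{1..m}. g i \<in> L2_functions Q) \<and>
       (\<forall>k\<in>F. \<exists>i\<in>{1..m}. L2_seminorm Q (\<lambda>z. k z - g i z) \<le> \<epsilon>)}"

definition kernel_class :: "('a::real_vector \<Rightarrow> real) \<Rightarrow> ('a \<Rightarrow> real) set" where
  "kernel_class \<Lambda> = {(\<lambda>z. \<Lambda> ((x - z) /\<^sub>R h)) | x h. 0 < h}"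

definition covering_number_condition :: "('a::euclidean_space \<Rightarrow> real) \<Rightarrow> bool" where
  "covering_number_condition \<Lambda> \<longleftrightarrow>
     (\<exists>A>0. \<exists>v>0. \<forall>Q. prob_space Q \<and> sets Q = sets borel \<longrightarrow>
        (\<forall>\<epsilon>\<in>{0<..<1}.
           ereal_of_enat (covering_number (\<epsilon> * (SUP x. \<bar>\<Lambda> x\<bar>)) Q (kernel_class \<Lambda>))
             \<le> ereal ((A / \<epsilon>) powr v)))"

definition asymptotic_as_confidence_regions ::
  "'w measure \<Rightarrow> (nat \<Rightarrow> 'w \<Rightarrow> 'b set) \<Rightarrow> 'b \<Rightarrow> bool"
where
  "asymptotic_as_confidence_regions M D \<theta> \<longleftrightarrow>
     (\<exists>\<Omega>\<^sub>0\<in>sets M. measure M \<Omega>\<^sub>0 = 1 \<and> (\<forall>\<omega>\<in>\<Omega>\<^sub>0. \<exists>N. \<forall>n\<ge>N. \<theta> \<in> D n \<omega>))"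

end

theory Submission
  imports Defs
begin

text \<open>
  Put \<open>a\<^sub>n = n h\<^sub>n*\<^sup>d / v\<^sub>n\<^sup>2\<close>. Since \<open>v\<^sub>n h\<^sub>n*\<^sup>2 \<rightarrow> 0\<close>, all rates are polynomial in \<open>1 / h\<^sub>n*\<close>, so by the Hoelder
  condition on \<open>K\<close> the supremum over \<open>C\<close> may be replaced by a maximum over a net whose cardinality is
  polynomial in \<open>1 / h\<^sub>n*\<close>, hence \<open>exp (o(a\<^sub>n))\<close>.
  On the net, Chernoff's inequality with a second-order expansion of the moment generating function
  gives the upper bound \<open>exp (- a\<^sub>n \<delta>\<^sup>2 / 2 + o(a\<^sub>n))\<close>, while \<open>f\<^sub>n\<close> deviates from \<open>f\<close> only with
  probability \<open>exp (- c n h\<^sub>n\<^sup>d)\<close>, and \<open>n h\<^sub>n\<^sup>d / a\<^sub>n \<rightarrow> \<infinity>\<close>. The lower bound comes from a single point of \<open>C\<close>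
  by Cramer's tilting argument. As \<open>a\<^sub>n / ln n \<rightarrow> \<infinity>\<close>, the probabilities are summable and the
  Borel-Cantelli lemma yields the almost sure statement.
\<close>

section \<open>Moment generating functions\<close>

text \<open>The limit sees neither f nor C because the band is scaled by the standard deviation:
  with tilt s / v_n the Chernoff exponent at y is a_n times s^2 f(y) \<kappa> / 2 - s \<delta> sqrt
  (f(y) \<kappa>), whose minimum over s is - \<delta>^2 / 2 at every y with f(y) > 0. Hence all
  points of C cost the same, and one of them already gives the lower bound. The width of the band is
  random through f_n. It is frozen by discarding the event that f_n is off by a fixed amount; since
  n h_n^d / a_n = v_n^2 h_n^d / hs_n^d (hs_n is the second bandwidth), that event is negligible
  against exp (- Z a_n) for every Z. Two bounds have to be extracted from the rates. From v_n^2
  hs_n^4 <= 1 and hs_n^d <= v_n^2 h_n^d follows hs_n^(d+4) <= h_n^d, so one net serves both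
  estimators. The logarithm in the first rate is ln (1 / hs_n), which may be far smaller than ln n;
  but if hs_n is that large, then a_n >= n hs_n^(d+4) already grows like a power of n.\<close>

lemma exp_second_order:
  fixes u :: real
  assumes "\<bar>u\<bar> \<le> 1"
  shows "\<bar>exp u - (1 + u + u\<^sup>2 / 2)\<bar> \<le> u\<^sup>2 / 2 * \<bar>u\<bar>"
proof -
  obtain t where t: "\<bar>t\<bar> \<le> \<bar>u\<bar>" "exp u = (\<Sum>m<3. (u ^ m) / fact m) + (exp t / fact 3) * u ^ 3"
    using Maclaurin_exp_le[of u 3] by auto
  have *: "exp u - (1 + u + u\<^sup>2 / 2) = exp t / 6 * u ^ 3"
    unfolding t(2) by (simp add: eval_nat_numeral lessThan_Suc field_simps)
  \<comment> \<open>Since exp 1 \<le> 3, the Lagrange remainder has constant 3/6 = 1/2. Keeping a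
    factor u^2 apart lets the remainder be charged to the variance.\<close>
  have "exp t \<le> exp 1" using t(1) assms by simp
  then have "exp t \<le> 3" using exp_le by linarith
  then have "exp t / 6 * \<bar>u\<bar> ^ 3 \<le> 1 / 2 * \<bar>u\<bar> ^ 3"
    by (intro mult_right_mono) auto
  also have "\<dots> = u\<^sup>2 / 2 * \<bar>u\<bar>"
    by (simp add: eval_nat_numeral field_simps)
  finally show ?thesis unfolding * by (simp add: abs_mult power_abs)
qed

text \<open>Centring removes the linear term, and |Y - EY| \<le> B turns the cubic remainder into
  the relative error |l| B on the quadratic one. Both bounds are sharp to leading order as l tends
  to 0, which is the regime l = s / v_n in which they are used.\<close>

lemma (in prob_space)
  fixes Y :: "'a \<Rightarrow> real"
  assumes Y[measurable]: "random_variable borel Y"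
    and bnd: "\<And>\<omega>. 0 \<le> Y \<omega>" "\<And>\<omega>. Y \<omega> \<le> B"
    and l: "\<bar>l\<bar> * B \<le> 1"
  shows centred_mgf_le: "expectation (\<lambda>\<omega>. exp (l * (Y \<omega> - expectation Y)))
      \<le> 1 + l\<^sup>2 / 2 * (1 + \<bar>l\<bar> * B) * (expectation (\<lambda>\<omega>. (Y \<omega>)\<^sup>2) - (expectation Y)\<^sup>2)"
    and centred_mgf_ge: "expectation (\<lambda>\<omega>. exp (l * (Y \<omega> - expectation Y)))
      \<ge> 1 + l\<^sup>2 / 2 * (1 - \<bar>l\<bar> * B) * (expectation (\<lambda>\<omega>. (Y \<omega>)\<^sup>2) - (expectation Y)\<^sup>2)"
proof -
  \<comment> \<open>The bounds on Y hold at every element of the type, so an arbitrary one gives the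
    sign of B.\<close>
  have B: "0 \<le> B" using bnd[of "undefined"] by linarith
  have iY[simp]: "integrable M Y"
    using bnd by (intro integrable_const_bound[of _ B]) auto
  have iY2[simp]: "integrable M (\<lambda>\<omega>. (Y \<omega>)\<^sup>2)"
    using bnd by (intro integrable_const_bound[of _ "B\<^sup>2"]) (auto intro!: power_mono)
  define m where "m = expectation Y"
  have m: "0 \<le> m" "m \<le> B"
    unfolding m_def using bnd by (auto intro!: Bochner_Integration.integral_nonneg integral_le_const)
  have U: "\<bar>Y \<omega> - m\<bar> \<le> B" for \<omega> using bnd[of \<omega>] m by auto
  have lU: "\<bar>l * (Y \<omega> - m)\<bar> \<le> \<bar>l\<bar> * B" for \<omega>
    using U[of \<omega>] by (auto simp: abs_mult intro!: mult_left_mono)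
  have iU2[simp]: "integrable M (\<lambda>\<omega>. (Y \<omega> - m)\<^sup>2)"
    by (auto simp: power2_diff)
  have EU2: "expectation (\<lambda>\<omega>. (Y \<omega> - m)\<^sup>2) = expectation (\<lambda>\<omega>. (Y \<omega>)\<^sup>2) - m\<^sup>2"
    by (simp add: power2_diff prob_space) (simp add: m_def[symmetric] power2_eq_square)
  have iexp[simp]: "integrable M (\<lambda>\<omega>. exp (l * (Y \<omega> - m)))"
    using lU by (intro integrable_const_bound[of _ "exp (\<bar>l\<bar> * B)"]) (auto intro: order_trans[OF abs_ge_self])
  have pt: "\<bar>exp (l * (Y \<omega> - m)) - (1 + l * (Y \<omega> - m) + l\<^sup>2 / 2 * (Y \<omega> - m)\<^sup>2)\<bar>
     \<le> l\<^sup>2 / 2 * (\<bar>l\<bar> * B) * (Y \<omega> - m)\<^sup>2" for \<omega>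
  proof -
    have "\<bar>exp (l * (Y \<omega> - m)) - (1 + l * (Y \<omega> - m) + (l * (Y \<omega> - m))\<^sup>2 / 2)\<bar>
       \<le> (l * (Y \<omega> - m))\<^sup>2 / 2 * \<bar>l * (Y \<omega> - m)\<bar>"
      using lU[of \<omega>] l by (intro exp_second_order) linarith
    also have "\<dots> \<le> (l * (Y \<omega> - m))\<^sup>2 / 2 * (\<bar>l\<bar> * B)"
      using lU[of \<omega>] by (intro mult_left_mono) auto
    finally show ?thesis by (simp add: power_mult_distrib mult_ac)
  qed
  have E: "expectation (\<lambda>\<omega>. 1 + l * (Y \<omega> - m) + l\<^sup>2 / 2 * c * (Y \<omega> - m)\<^sup>2)
      = 1 + l\<^sup>2 / 2 * c * (expectation (\<lambda>\<omega>. (Y \<omega>)\<^sup>2) - m\<^sup>2)" for c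
    by (simp add: EU2 prob_space) (simp add: m_def)
  have "expectation (\<lambda>\<omega>. exp (l * (Y \<omega> - m)))
      \<le> expectation (\<lambda>\<omega>. 1 + l * (Y \<omega> - m) + l\<^sup>2 / 2 * (1 + \<bar>l\<bar> * B) * (Y \<omega> - m)\<^sup>2)"
  proof (rule integral_mono)
    fix \<omega> show "exp (l * (Y \<omega> - m)) \<le> 1 + l * (Y \<omega> - m) + l\<^sup>2 / 2 * (1 + \<bar>l\<bar> * B) * (Y \<omega> - m)\<^sup>2"
      using pt[of \<omega>] unfolding abs_le_iff distrib_left distrib_right left_diff_distrib right_diff_distrib by linarith
  qed auto
  then show "expectation (\<lambda>\<omega>. exp (l * (Y \<omega> - expectation Y)))
      \<le> 1 + l\<^sup>2 / 2 * (1 + \<bar>l\<bar> * B) * (expectation (\<lambda>\<omega>. (Y \<omega>)\<^sup>2) - (expectation Y)\<^sup>2)"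
    unfolding E unfolding m_def .
  have "expectation (\<lambda>\<omega>. 1 + l * (Y \<omega> - m) + l\<^sup>2 / 2 * (1 - \<bar>l\<bar> * B) * (Y \<omega> - m)\<^sup>2)
      \<le> expectation (\<lambda>\<omega>. exp (l * (Y \<omega> - m)))"
  proof (rule integral_mono)
    fix \<omega> show "1 + l * (Y \<omega> - m) + l\<^sup>2 / 2 * (1 - \<bar>l\<bar> * B) * (Y \<omega> - m)\<^sup>2 \<le> exp (l * (Y \<omega> - m))"
      using pt[of \<omega>] unfolding abs_le_iff distrib_left distrib_right left_diff_distrib right_diff_distrib by linarith
  qed auto
  then show "expectation (\<lambda>\<omega>. exp (l * (Y \<omega> - expectation Y)))
      \<ge> 1 + l\<^sup>2 / 2 * (1 - \<bar>l\<bar> * B) * (expectation (\<lambda>\<omega>. (Y \<omega>)\<^sup>2) - (expectation Y)\<^sup>2)"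
    unfolding E unfolding m_def .
qed

text \<open>Cramer's lower bound, from the limiting logarithmic moment generating function s^2 V / 2
  alone. No tilted measure is formed: the moment at s is split according to whether
  \<open>Z n\<close> lies within \<eta> of the tilted mean s V. Outside this window it is dominated
  by the moments at s + r and s - r, which are exponentially smaller once the window is paid for, so
  at least half of the moment comes from the window, where \<open>Z n\<close> exceeds t.\<close>

lemma (in prob_space) exponential_lower_bound:
  fixes Z :: "nat \<Rightarrow> 'a \<Rightarrow> real" and a :: "nat \<Rightarrow> real"
  assumes Z[measurable]: "\<And>n. random_variable borel (Z n)"
    and int: "\<And>n s. integrable M (\<lambda>\<omega>. exp (s * a n * Z n \<omega>))"
    and a: "filterlim a at_top sequentially"
    and lim: "\<And>s. 0 < s \<Longrightarrow>
      (\<lambda>n. ln (expectation (\<lambda>\<omega>. exp (s * a n * Z n \<omega>))) / a n) \<longlonglongrightarrow> s\<^sup>2 * V / 2"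
    and V: "0 < V" and t: "0 < t" and e: "0 < \<epsilon>"
  shows "\<forall>\<^sub>F n in sequentially. exp (- a n * (t\<^sup>2 / (2 * V) + \<epsilon>)) \<le> prob {\<omega> \<in> space M. t < Z n \<omega>}"
proof -
  have "((\<lambda>\<eta>. (t + 2 * \<eta>)\<^sup>2 / (2 * V) + \<eta> * (t + 2 * \<eta>) / V) \<longlongrightarrow> (t + 2 * 0)\<^sup>2 / (2 * V) + 0 * (t + 2 * 0) / V) (at_right 0)"
    by (intro tendsto_intros) (use V in auto)
  then have "\<forall>\<^sub>F \<eta> in at_right 0. (t + 2 * \<eta>)\<^sup>2 / (2 * V) + \<eta> * (t + 2 * \<eta>) / V < t\<^sup>2 / (2 * V) + \<epsilon> / 2"
    by (rule order_tendstoD) (use e in auto)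
  then have "\<forall>\<^sub>F \<eta> in at_right 0. (t + 2 * \<eta>)\<^sup>2 / (2 * V) + \<eta> * (t + 2 * \<eta>) / V < t\<^sup>2 / (2 * V) + \<epsilon> / 2 \<and> 0 < \<eta>"
    by (intro eventually_conj) (auto simp: eventually_at_right_less)
  then obtain \<eta> where eta: "0 < \<eta>" "(t + 2 * \<eta>)\<^sup>2 / (2 * V) + \<eta> * (t + 2 * \<eta>) / V < t\<^sup>2 / (2 * V) + \<epsilon> / 2"
    using eventually_happens'[OF trivial_limit_at_right_real] by blast
  \<comment> \<open>The tilted mean s V = t + 2 \<eta> puts the window of radius \<eta> strictly to
    the right of t. Its cost exceeds t^2 / (2 V) by a term that vanishes with \<eta>.\<close>
  define s where "s = (t + 2 * \<eta>) / V"
  have s: "0 < s" and sV: "s * V = t + 2 * \<eta>" using V t eta by (auto simp: s_def)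
  have cost: "s * (s * V + \<eta>) - s\<^sup>2 * V / 2 < t\<^sup>2 / (2 * V) + \<epsilon> / 2"
  proof -
    have "s * (s * V + \<eta>) - s\<^sup>2 * V / 2 = (t + 2 * \<eta>)\<^sup>2 / (2 * V) + \<eta> * (t + 2 * \<eta>) / V"
      using V by (simp add: s_def field_simps power2_eq_square)
    then show ?thesis using eta by simp
  qed
  have exp_split: "exp (u - ln 2 - w) = exp u / 2 * exp (- w)" for u w :: real
    by (simp only: exp_diff exp_ln[OF zero_less_numeral] exp_minus[of w] divide_inverse[of _ "exp w"])
  \<comment> \<open>The bound s / 2 keeps s - r positive, where the limit is available; \<eta> / V
    makes the second-order loss r^2 V / 2 at most half of the gain r \<eta>; \<epsilon> / \<eta>
    keeps the gap g below \<epsilon> / 2.\<close>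
  define r where "r = Min {s / 2, \<eta> / V, \<epsilon> / \<eta>}"
  have r: "0 < r" "r < s" "r \<le> \<eta> / V" "r \<le> \<epsilon> / \<eta>" using s eta V e by (auto simp: r_def)
  define g where "g = r * \<eta> / 2"
  have g: "0 < g" "g \<le> \<epsilon> / 2" using r eta by (auto simp: g_def field_simps)
  have rV: "r\<^sup>2 * V / 2 \<le> g"
    using r eta V mult_left_mono[of "r * V" \<eta> r] by (simp add: g_def field_simps power2_eq_square)
  define L where "L s n = expectation (\<lambda>\<omega>. exp (s * a n * Z n \<omega>))" for s n
  have Lpos: "0 < L s n" for s n
  proof -
    have "L s n \<ge> 0" unfolding L_def by (intro Bochner_Integration.integral_nonneg) auto
    moreover have "L s n \<noteq> 0"
      unfolding L_def using int[of s n]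
      by (subst integral_nonneg_eq_0_iff_AE) auto
    ultimately show ?thesis by linarith
  qed
  have L: "\<And>s. 0 < s \<Longrightarrow> (\<lambda>n. ln (L s n) / a n) \<longlonglongrightarrow> s\<^sup>2 * V / 2"
    using lim unfolding L_def .
  \<comment> \<open>The threshold with ln 4 makes exp (g A / 2) at least 4, so that the two outer
    pieces together are at most half of the moment; the one with ln 2 absorbs the remaining factor
    1/2 into \<epsilon> A / 4.\<close>
  have apos: "\<forall>\<^sub>F n in sequentially. max 1 (max (ln 4 * 2 / g) (ln 2 * 4 / \<epsilon>)) \<le> a n"
    using a unfolding filterlim_at_top by blast
  have "\<forall>\<^sub>F n in sequentially. s\<^sup>2 * V / 2 - g / 4 < ln (L s n) / a n"
    using order_tendstoD(1)[OF L[OF s]] g by simp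
  moreover have "\<forall>\<^sub>F n in sequentially. ln (L (s + r) n) / a n < (s + r)\<^sup>2 * V / 2 + g / 4"
    using order_tendstoD(2)[OF L[of "s + r"]] g s r by simp
  moreover have "\<forall>\<^sub>F n in sequentially. ln (L (s - r) n) / a n < (s - r)\<^sup>2 * V / 2 + g / 4"
    using order_tendstoD(2)[OF L[of "s - r"]] g s r by simp
  ultimately show ?thesis using apos
  proof eventually_elim
    case (elim n)
    define A where "A = a n"
    have A: "1 \<le> A" "ln 4 * 2 \<le> g * A" "ln 2 * 4 \<le> \<epsilon> * A"
      using elim(4) g e by (auto simp: A_def field_simps)
    have low: "exp (A * (s\<^sup>2 * V / 2 - g / 4)) \<le> L s n"
    proof -
      have "A * (s\<^sup>2 * V / 2 - g / 4) \<le> ln (L s n)"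
        using elim(1) A by (simp add: A_def[symmetric] field_simps)
      then show ?thesis using Lpos[of s n] by (metis exp_le_cancel_iff exp_ln)
    qed
    have up: "L s' n \<le> exp (A * (s'\<^sup>2 * V / 2 + g / 4))" if "ln (L s' n) / a n < s'\<^sup>2 * V / 2 + g / 4" for s'
    proof -
      have "ln (L s' n) \<le> A * (s'\<^sup>2 * V / 2 + g / 4)"
        using that A by (simp add: A_def[symmetric] field_simps)
      then show ?thesis using Lpos[of s' n] by (metis exp_le_cancel_iff exp_ln)
    qed
    define P where "P = prob {\<omega> \<in> space M. t < Z n \<omega>}"
    have int': "integrable M (\<lambda>\<omega>. exp (s * A * Z n \<omega>))" for s
      using int[of s n] by (simp add: A_def)
    have split: "exp (s * A * Z n \<omega>) \<le> exp (s * A * (s * V + \<eta>)) * indicator {\<omega> \<in> space M. t < Z n \<omega>} \<omega>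
        + exp ((s + r) * A * Z n \<omega>) * exp (- r * A * (s * V + \<eta>))
        + exp ((s - r) * A * Z n \<omega>) * exp (r * A * (s * V - \<eta>))" (is "_ \<le> ?a + ?b + ?c") if "\<omega> \<in> space M" for \<omega>
    proof -
      have nn: "0 \<le> ?a" "0 \<le> ?b" "0 \<le> ?c" by (auto simp: indicator_def)
      consider "Z n \<omega> \<ge> s * V + \<eta>" | "Z n \<omega> \<le> s * V - \<eta>" | "\<bar>Z n \<omega> - s * V\<bar> < \<eta>" by linarith
      then show ?thesis
      proof cases
        case 1
        then have "r * A * (s * V + \<eta>) \<le> r * A * Z n \<omega>"
          using r A by (intro mult_left_mono) auto
        then have "exp (s * A * Z n \<omega>) \<le> ?b"
          by (simp add: exp_add[symmetric] algebra_simps)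
        then show ?thesis using nn by linarith
      next
        case 2
        then have "r * A * Z n \<omega> \<le> r * A * (s * V - \<eta>)"
          using r A by (intro mult_left_mono) auto
        then have "exp (s * A * Z n \<omega>) \<le> ?c"
          by (simp add: exp_add[symmetric] algebra_simps)
        then show ?thesis using nn by linarith
      next
        case 3
        then have "s * A * Z n \<omega> \<le> s * A * (s * V + \<eta>)"
          using s A by (intro mult_left_mono) auto
        moreover have "t < Z n \<omega>" using 3 sV eta by linarith
        ultimately have "exp (s * A * Z n \<omega>) \<le> ?a" using that by simp
        then show ?thesis using nn by linarith
      qed
    qed
    have "L s n \<le> expectation (\<lambda>\<omega>. exp (s * A * (s * V + \<eta>)) * indicator {\<omega> \<in> space M. t < Z n \<omega>} \<omega>
        + exp ((s + r) * A * Z n \<omega>) * exp (- r * A * (s * V + \<eta>))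
        + exp ((s - r) * A * Z n \<omega>) * exp (r * A * (s * V - \<eta>)))"
      unfolding L_def A_def[symmetric]
      by (intro integral_mono split int' Bochner_Integration.integrable_add
          integrable_mult_right integrable_mult_left integrable_real_indicator) (auto simp: emeasure_eq_measure)
    also have "\<dots> = exp (s * A * (s * V + \<eta>)) * P + L (s + r) n * exp (- r * A * (s * V + \<eta>))
        + L (s - r) n * exp (r * A * (s * V - \<eta>))"
      by (simp add: int' P_def L_def A_def[symmetric] emeasure_eq_measure)
    also have "\<dots> \<le> exp (s * A * (s * V + \<eta>)) * P
        + exp (A * ((s + r)\<^sup>2 * V / 2 + g / 4)) * exp (- r * A * (s * V + \<eta>))
        + exp (A * ((s - r)\<^sup>2 * V / 2 + g / 4)) * exp (r * A * (s * V - \<eta>))"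
      by (intro add_mono mult_right_mono up elim order_refl) auto
    \<comment> \<open>Here r \<eta> = 2 g and r^2 V / 2 \<le> g: each outer exponent is at most s^2
      V / 2 + g + g/4 - 2 g, hence g/2 below the lower bound \<open>low\<close>.\<close>
    also have "\<dots> \<le> exp (s * A * (s * V + \<eta>)) * P
        + exp (A * (s\<^sup>2 * V / 2 - 3 * g / 4)) + exp (A * (s\<^sup>2 * V / 2 - 3 * g / 4))"
    proof -
      have "(s + r)\<^sup>2 * V / 2 + g / 4 - r * (s * V + \<eta>) \<le> s\<^sup>2 * V / 2 - 3 * g / 4"
           "(s - r)\<^sup>2 * V / 2 + g / 4 + r * (s * V - \<eta>) \<le> s\<^sup>2 * V / 2 - 3 * g / 4"
        using rV by (simp_all add: g_def power2_eq_square field_simps)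
      then have le: "exp (A * ((s + r)\<^sup>2 * V / 2 + g / 4 - r * (s * V + \<eta>))) \<le> exp (A * (s\<^sup>2 * V / 2 - 3 * g / 4))"
           "exp (A * ((s - r)\<^sup>2 * V / 2 + g / 4 + r * (s * V - \<eta>))) \<le> exp (A * (s\<^sup>2 * V / 2 - 3 * g / 4))"
        using A by auto
      have eq: "exp (A * (u + g / 4)) * exp (- r * A * w) = exp (A * (u + g / 4 - r * w))"
        "exp (A * (u + g / 4)) * exp (r * A * w) = exp (A * (u + g / 4 + r * w))" for u w
        by (simp_all add: exp_add[symmetric] algebra_simps)
      show ?thesis unfolding eq by (intro add_mono order_refl le)
    qed
    also have "\<dots> \<le> exp (s * A * (s * V + \<eta>)) * P + exp (A * (s\<^sup>2 * V / 2 - g / 4)) / 2"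
    proof -
      have "ln 4 \<le> g * A / 2" using A by simp
      then have "4 \<le> exp (g * A / 2)" by (metis exp_ln exp_le_cancel_iff zero_less_numeral)
      then have "4 * exp (A * (s\<^sup>2 * V / 2 - 3 * g / 4)) \<le> exp (g * A / 2) * exp (A * (s\<^sup>2 * V / 2 - 3 * g / 4))"
        by (intro mult_right_mono) auto
      also have "\<dots> = exp (A * (s\<^sup>2 * V / 2 - g / 4))"
        by (simp add: exp_add[symmetric] algebra_simps)
      finally show ?thesis by simp
    qed
    finally have "exp (A * (s\<^sup>2 * V / 2 - g / 4)) / 2 \<le> exp (s * A * (s * V + \<eta>)) * P"
      using low by linarith
    then have "exp (A * (s\<^sup>2 * V / 2 - g / 4)) / 2 * exp (- (s * A * (s * V + \<eta>)))
      \<le> exp (s * A * (s * V + \<eta>)) * P * exp (- (s * A * (s * V + \<eta>)))"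
      by (rule mult_right_mono) simp
    also have "\<dots> = P" by (simp add: exp_minus)
    finally have "exp (A * (s\<^sup>2 * V / 2 - g / 4)) / 2 * exp (- (s * A * (s * V + \<eta>))) \<le> P" .
    moreover have "exp (- A * (t\<^sup>2 / (2 * V) + \<epsilon>)) \<le> exp (A * (s\<^sup>2 * V / 2 - g / 4)) / 2 * exp (- (s * A * (s * V + \<eta>)))"
    proof -
      have "A * (s * (s * V + \<eta>) - s\<^sup>2 * V / 2 + g / 4 + \<epsilon> / 4) \<le> A * (t\<^sup>2 / (2 * V) + \<epsilon>)"
        using cost g A e by (intro mult_left_mono) auto
      then have "- A * (t\<^sup>2 / (2 * V) + \<epsilon>) \<le> A * (s\<^sup>2 * V / 2 - g / 4) - ln 2 - s * A * (s * V + \<eta>)"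
        using A(3) by (simp add: algebra_simps)
      then have "exp (- A * (t\<^sup>2 / (2 * V) + \<epsilon>)) \<le> exp (A * (s\<^sup>2 * V / 2 - g / 4) - ln 2 - s * A * (s * V + \<eta>))"
        by simp
      also have "\<dots> = exp (A * (s\<^sup>2 * V / 2 - g / 4)) / 2 * exp (- (s * A * (s * V + \<eta>)))"
        by (rule exp_split)
      finally show ?thesis .
    qed
    ultimately have "exp (- A * (t\<^sup>2 / (2 * V) + \<epsilon>)) \<le> P" by (rule order_trans[rotated])
    then show ?case unfolding P_def A_def .
  qed
qed

section \<open>Kernel estimators of a smooth density\<close>

text \<open>The substitution y = x - h z; the reflection enters the Jacobian only through the
  absolute value of - h.\<close>

lemma lborel_integral_rescale:
  fixes g :: "'a::euclidean_space \<Rightarrow> real"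
  assumes [measurable]: "g \<in> borel_measurable borel" and h: "0 < h"
  shows "(LINT y|lborel. g y) = h ^ DIM('a) * (LINT z|lborel. g (x - h *\<^sub>R z))"
proof -
  have "(LINT y|lborel. g y) = (LINT y|density (distr lborel borel (\<lambda>z. x + (- h) *\<^sub>R z)) (\<lambda>_. \<bar>- h\<bar> ^ DIM('a)). g y)"
    using lborel_affine[of "- h" x] h by simp
  also have "\<dots> = (LINT y|distr lborel borel (\<lambda>z. x + (- h) *\<^sub>R z). h ^ DIM('a) * g y)"
    using h by (subst integral_density) auto
  also have "\<dots> = (LINT z|lborel. h ^ DIM('a) * g (x + (- h) *\<^sub>R z))"
    by (subst integral_distr) auto
  also have "\<dots> = h ^ DIM('a) * (LINT z|lborel. g (x - h *\<^sub>R z))"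
    by simp
  finally show ?thesis .
qed

section \<open>Independent samples with a common density\<close>

locale iid_sample = prob_space M for M :: "'w measure" +
  fixes X :: "nat \<Rightarrow> 'w \<Rightarrow> 'a::euclidean_space" and f :: "'a \<Rightarrow> real"
  assumes indep: "indep_vars (\<lambda>_. borel) X {1..}"
    and density: "\<And>j. 1 \<le> j \<Longrightarrow> distributed M lborel (X j) (\<lambda>x. ennreal (f x))"
    and f_nonneg: "\<And>x. 0 \<le> f x"
begin

lemma X_measurable: "1 \<le> j \<Longrightarrow> random_variable borel (X j)"
  using distributed_measurable[OF density] by simp

lemma f_measurable[measurable]: "f \<in> borel_measurable borel"
  using distributed_real_measurable[OF _ density[of 1]] f_nonneg by simp

lemma expectation_density:
  assumes "g \<in> borel_measurable borel" "1 \<le> j"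
  shows "expectation (\<lambda>\<omega>. g (X j \<omega>)) = (LINT y|lborel. f y * g y)"
  using distributed_integral[OF density[OF assms(2)], of g] assms(1) f_nonneg by simp

lemma mgf_sum:
  fixes g :: "'a \<Rightarrow> real"
  assumes g[measurable]: "g \<in> borel_measurable borel" and bnd: "\<And>y. \<bar>g y\<bar> \<le> b"
  shows "integrable M (\<lambda>\<omega>. exp (c * (\<Sum>j = 1..n. g (X j \<omega>))))"
    and "expectation (\<lambda>\<omega>. exp (c * (\<Sum>j = 1..n. g (X j \<omega>)))) = expectation (\<lambda>\<omega>. exp (c * g (X 1 \<omega>))) ^ n"
proof -
  define Y where "Y j \<omega> = exp (c * g (X j \<omega>))" for j \<omega>
  have eq: "exp (c * (\<Sum>j = 1..n. g (X j \<omega>))) = (\<Prod>j\<in>{1..n}. Y j \<omega>)" for \<omega>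
    by (simp add: Y_def sum_distrib_left exp_sum)
  have ind: "indep_vars (\<lambda>_. borel) (\<lambda>j \<omega>. Y j \<omega>) {1..n}"
    unfolding Y_def using indep_vars_subset[OF indep, of "{1..n}"]
    by (intro indep_vars_compose2[where Y="\<lambda>_ y. exp (c * g y)"]) auto
  have int: "integrable M (Y j)" if "j \<in> {1..n}" for j
  proof -
    have [measurable]: "random_variable borel (X j)" using that X_measurable by simp
    have "c * g y \<le> \<bar>c\<bar> * b" for y
    proof -
      have "c * g y \<le> \<bar>c\<bar> * \<bar>g y\<bar>" by (metis abs_ge_self abs_mult)
      also have "\<dots> \<le> \<bar>c\<bar> * b" using bnd by (intro mult_left_mono) auto
      finally show ?thesis .
    qed
    then show ?thesis unfolding Y_def
      by (intro integrable_const_bound[of _ "exp (\<bar>c\<bar> * b)"]) auto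
  qed
  show "integrable M (\<lambda>\<omega>. exp (c * (\<Sum>j = 1..n. g (X j \<omega>))))"
    unfolding eq by (intro indep_vars_integrable ind int) auto
  have "expectation (\<lambda>\<omega>. exp (c * (\<Sum>j = 1..n. g (X j \<omega>)))) = (\<Prod>j\<in>{1..n}. expectation (Y j))"
    unfolding eq by (intro indep_vars_lebesgue_integral ind int) auto
  also have "\<dots> = (\<Prod>j\<in>{1..n}. expectation (Y 1))"
  proof (rule prod.cong)
    fix j assume "j \<in> {1..n}"
    then show "expectation (Y j) = expectation (Y 1)"
      unfolding Y_def
      using expectation_density[of "\<lambda>y. exp (c * g y)" j] expectation_density[of "\<lambda>y. exp (c * g y)" 1] by simp
  qed simp
  finally show "expectation (\<lambda>\<omega>. exp (c * (\<Sum>j = 1..n. g (X j \<omega>)))) = expectation (\<lambda>\<omega>. exp (c * g (X 1 \<omega>))) ^ n"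
    by (simp add: Y_def[abs_def])
qed

end

text \<open>Smoothness and boundedness enter as inequalities with fixed constants, so that all later
  estimates are uniform in the point, the bandwidth and the sample size, and derivatives do not
  appear again.\<close>

locale kernel_sample = iid_sample M X f
  for M :: "'w measure" and X :: "nat \<Rightarrow> 'w \<Rightarrow> real ^ 'n" and f +
  fixes K :: "real ^ 'n \<Rightarrow> real" and gradf :: "real ^ 'n \<Rightarrow> real ^ 'n" and B F G H L \<alpha> :: real
  assumes K_nonneg: "\<And>z. 0 \<le> K z" and K_le: "\<And>z. K z \<le> B" and B_pos: "0 < B"
    and K_integral: "has_bochner_integral lborel K 1"
    and K_centred: "\<And>j. has_bochner_integral lborel (\<lambda>z. z $ j * K z) 0"
    and K_second_moment: "integrable lborel (\<lambda>z. (norm z)\<^sup>2 * K z)"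
    and f_le: "\<And>x. f x \<le> F"
    and f_Lipschitz: "\<And>x y. \<bar>f x - f y\<bar> \<le> G * norm (x - y)"
    and f_Taylor: "\<And>x u. \<bar>f (x + u) - f x - gradf x \<bullet> u\<bar> \<le> H * (norm u)\<^sup>2"
    and K_Hoelder: "\<And>x y. \<bar>K x - K y\<bar> \<le> L * norm (x - y) powr \<alpha>"
    and \<alpha>_pos: "0 < \<alpha>" and consts_nonneg: "0 \<le> G" "0 \<le> H" "0 \<le> L"
begin

text \<open>For h > 0 and n \<ge> 1 this is the mean of the estimator with bandwidth h, after the
  substitution y = x - h z. Likewise \<open>smoothed_sq h x\<close> is the second moment of one
  summand divided by h^d.\<close>

definition smoothed :: "real \<Rightarrow> real ^ 'n \<Rightarrow> real"
  where "smoothed h x = (LINT z|lborel. K z * f (x - h *\<^sub>R z))"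

definition smoothed_sq :: "real \<Rightarrow> real ^ 'n \<Rightarrow> real"
  where "smoothed_sq h x = (LINT z|lborel. (K z)\<^sup>2 * f (x - h *\<^sub>R z))"

definition m1 :: real where "m1 = (LINT z|lborel. norm z * K z)"
definition m2 :: real where "m2 = (LINT z|lborel. (norm z)\<^sup>2 * K z)"

abbreviation \<kappa> :: real where "\<kappa> \<equiv> kernel_kappa K"

abbreviation est :: "real \<Rightarrow> nat \<Rightarrow> 'w \<Rightarrow> real ^ 'n \<Rightarrow> real"
  where "est h n \<omega> \<equiv> kernel_estimator K h (\<lambda>j. X j \<omega>) n"

lemma K_continuous: "continuous_on UNIV K"
proof -
  have "\<exists>d>0. \<forall>y. dist y x < d \<longrightarrow> dist (K y) (K x) < e" if "0 < e" for x e
  proof -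
    have "((\<lambda>y. L * norm (y - x) powr \<alpha>) \<longlongrightarrow> L * norm (x - x) powr \<alpha>) (nhds x)"
      using \<alpha>_pos by (intro tendsto_intros filterlim_ident) auto
    then have "\<forall>\<^sub>F y in nhds x. L * norm (y - x) powr \<alpha> < e"
      by (rule order_tendstoD) (use that in auto)
    then obtain d where "d > 0" "\<And>y. dist y x < d \<Longrightarrow> L * norm (y - x) powr \<alpha> < e"
      unfolding eventually_nhds_metric by blast
    then show ?thesis using K_Hoelder
      by (intro exI[of _ d]) (auto simp: dist_real_def intro: le_less_trans)
  qed
  then show ?thesis by (auto simp: continuous_on_iff)
qed

lemma K_measurable[measurable]: "K \<in> borel_measurable borel"
  using K_continuous by (rule borel_measurable_continuous_onI)

lemma f_continuous: "continuous_on UNIV f"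
proof -
  have "\<exists>d>0. \<forall>y. dist y x < d \<longrightarrow> dist (f y) (f x) < e" if "0 < e" for x e
  proof (intro exI[of _ "e / (G + 1)"] conjI allI impI)
    show "0 < e / (G + 1)" using that consts_nonneg by simp
    fix y assume "dist y x < e / (G + 1)"
    then have *: "(G + 1) * norm (y - x) < e"
      using consts_nonneg by (simp add: dist_norm field_simps)
    have "\<bar>f y - f x\<bar> \<le> (G + 1) * norm (y - x)"
      using f_Lipschitz[of y x] norm_ge_zero[of "y - x"] unfolding distrib_right by linarith
    then show "dist (f y) (f x) < e" using * by (simp add: dist_real_def)
  qed
  then show ?thesis by (auto simp: continuous_on_iff)
qed

lemma F_nonneg: "0 \<le> F" using f_nonneg f_le by (rule order_trans)

lemma K_integrable: "integrable lborel K" and K_int: "(LINT z|lborel. K z) = 1"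
  using K_integral by (auto simp: has_bochner_integral_iff)

lemma K_first_moment: "integrable lborel (\<lambda>z. norm z * K z)"
proof (rule Bochner_Integration.integrable_bound)
  show "integrable lborel (\<lambda>z. K z + (norm z)\<^sup>2 * K z)"
    using K_integrable K_second_moment by simp
  show "AE z in lborel. norm (norm z * K z) \<le> norm (K z + (norm z)\<^sup>2 * K z)"
  proof (rule AE_I2)
    fix z :: "real ^ 'n"
    have "0 \<le> (norm z - 1)\<^sup>2" by simp
    then have "2 * norm z \<le> (norm z)\<^sup>2 + 1" by (simp add: power2_diff)
    then have "norm z \<le> 1 + (norm z)\<^sup>2"
      using norm_ge_zero[of z] by linarith
    then have "norm z * K z \<le> (1 + (norm z)\<^sup>2) * K z"
      by (intro mult_right_mono K_nonneg)
    then show "norm (norm z * K z) \<le> norm (K z + (norm z)\<^sup>2 * K z)"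
      using K_nonneg[of z] by (simp add: algebra_simps)
  qed
qed simp

lemma K_sq_le: "(K z)\<^sup>2 \<le> B * K z"
  using K_le[of z] K_nonneg[of z] by (simp add: power2_eq_square mult_right_mono)

lemma K_sq_integrable: "integrable lborel (\<lambda>z. (K z)\<^sup>2)"
  by (rule Bochner_Integration.integrable_bound[OF integrable_mult_right[OF K_integrable, of B]])
    (use K_sq_le K_nonneg B_pos in auto)

text \<open>If \<kappa> vanished, K would be 0 almost everywhere, against its integral being 1. The
  optimal tilt divides by sqrt (f(y) \<kappa>).\<close>

lemma kappa_pos: "0 < \<kappa>"
proof -
  have "\<kappa> \<noteq> 0"
  proof
    assume "\<kappa> = 0"
    then have "AE z in lborel. (K z)\<^sup>2 = 0"
      unfolding kernel_kappa_def using K_sq_integrable by (subst (asm) integral_nonneg_eq_0_iff_AE) auto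
    then have "AE z in lborel. K z = 0" by simp
    from integral_cong_AE[OF _ _ this] have "(LINT z|lborel. K z) = (LINT z|lborel. 0)" by simp
    then show False using K_int by simp
  qed
  moreover have "0 \<le> \<kappa>" unfolding kernel_kappa_def by simp
  ultimately show ?thesis by linarith
qed

section \<open>Bias of the kernel means\<close>

lemma m1_nonneg: "0 \<le> m1"
  unfolding m1_def using K_nonneg by (auto intro!: Bochner_Integration.integral_nonneg)

lemma smoothed_integrable: "integrable lborel (\<lambda>z. K z * f (x - h *\<^sub>R z))"
  by (rule Bochner_Integration.integrable_bound[OF integrable_mult_left[OF K_integrable, of F]])
    (use f_nonneg f_le K_nonneg F_nonneg in \<open>auto intro!: mult_left_mono\<close>)

lemma smoothed_sq_integrable: "integrable lborel (\<lambda>z. (K z)\<^sup>2 * f (x - h *\<^sub>R z))"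
  by (rule Bochner_Integration.integrable_bound[OF integrable_mult_left[OF K_sq_integrable, of F]])
    (use f_nonneg f_le K_nonneg F_nonneg in \<open>auto intro!: mult_left_mono\<close>)

lemma smoothed_nonneg: "0 \<le> smoothed h x"
  unfolding smoothed_def using f_nonneg K_nonneg by (auto intro!: Bochner_Integration.integral_nonneg)

lemma smoothed_sq_le: "smoothed_sq h x \<le> F * \<kappa>"
proof -
  have "smoothed_sq h x \<le> (LINT z|lborel. (K z)\<^sup>2 * F)"
    unfolding smoothed_sq_def
    by (intro integral_mono smoothed_sq_integrable integrable_mult_left K_sq_integrable mult_left_mono f_le) simp
  then show ?thesis by (simp add: kernel_kappa_def mult.commute)
qed

lemma smoothed_sq_nonneg: "0 \<le> smoothed_sq h x"
  unfolding smoothed_sq_def using f_nonneg by (auto intro!: Bochner_Integration.integral_nonneg)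

text \<open>A first-order bound is enough wherever the bias only has to fall below a fixed
  tolerance, as for the estimator that sets the width of the band.\<close>

lemma smoothed_bias1:
  assumes "0 \<le> h" shows "\<bar>smoothed h x - f x\<bar> \<le> G * m1 * h"
proof -
  have "smoothed h x - f x = (LINT z|lborel. K z * f (x - h *\<^sub>R z)) - (LINT z|lborel. K z * f x)"
    using K_int by (simp add: smoothed_def)
  also have "\<dots> = (LINT z|lborel. K z * f (x - h *\<^sub>R z) - K z * f x)"
    by (intro Bochner_Integration.integral_diff[symmetric] smoothed_integrable integrable_mult_left K_integrable)
  also have "\<bar>\<dots>\<bar> \<le> (LINT z|lborel. G * h * (norm z * K z))"
    unfolding real_norm_def[symmetric]
  proof (rule Bochner_Integration.integral_norm_bound_integral)
    fix z
    have "\<bar>f (x - h *\<^sub>R z) - f x\<bar> \<le> G * (h * norm z)"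
      using f_Lipschitz[of "x - h *\<^sub>R z" x] assms by simp
    then have "K z * \<bar>f (x - h *\<^sub>R z) - f x\<bar> \<le> K z * (G * (h * norm z))"
      by (intro mult_left_mono K_nonneg)
    then show "norm (K z * f (x - h *\<^sub>R z) - K z * f x) \<le> G * h * (norm z * K z)"
      using K_nonneg[of z] by (simp add: right_diff_distrib[symmetric] abs_mult mult_ac)
  qed (intro Bochner_Integration.integrable_diff smoothed_integrable integrable_mult_left integrable_mult_right K_integrable K_first_moment)+
  finally show ?thesis by (simp add: m1_def mult_ac)
qed

text \<open>The estimate K^2 \<le> B K reduces the bias of the second moment to the first moment of
  K.\<close>

lemma smoothed_sq_bias:
  assumes "0 \<le> h" shows "\<bar>smoothed_sq h x - f x * \<kappa>\<bar> \<le> B * G * m1 * h"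
proof -
  have "smoothed_sq h x - f x * \<kappa> = (LINT z|lborel. (K z)\<^sup>2 * f (x - h *\<^sub>R z)) - (LINT z|lborel. (K z)\<^sup>2 * f x)"
    by (simp add: smoothed_sq_def kernel_kappa_def)
  also have "\<dots> = (LINT z|lborel. (K z)\<^sup>2 * f (x - h *\<^sub>R z) - (K z)\<^sup>2 * f x)"
    by (intro Bochner_Integration.integral_diff[symmetric] smoothed_sq_integrable integrable_mult_left K_sq_integrable)
  also have "\<bar>\<dots>\<bar> \<le> (LINT z|lborel. B * G * h * (norm z * K z))"
    unfolding real_norm_def[symmetric]
  proof (rule Bochner_Integration.integral_norm_bound_integral)
    fix z
    have "\<bar>f (x - h *\<^sub>R z) - f x\<bar> \<le> G * (h * norm z)"
      using f_Lipschitz[of "x - h *\<^sub>R z" x] assms by simp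
    then have "(K z)\<^sup>2 * \<bar>f (x - h *\<^sub>R z) - f x\<bar> \<le> (B * K z) * (G * (h * norm z))"
      using K_sq_le by (intro mult_mono) (use B_pos K_nonneg in auto)
    then show "norm ((K z)\<^sup>2 * f (x - h *\<^sub>R z) - (K z)\<^sup>2 * f x) \<le> B * G * h * (norm z * K z)"
      by (simp only: right_diff_distrib[symmetric] real_norm_def abs_mult abs_power2) (simp add: mult_ac)
  qed (intro Bochner_Integration.integrable_diff smoothed_sq_integrable integrable_mult_left integrable_mult_right K_sq_integrable K_first_moment)+
  finally show ?thesis by (simp add: m1_def mult_ac)
qed

text \<open>Centredness of K removes the linear Taylor term. The order h^2 is what
  \<open>rate2\<close> can absorb, since the bias at the centre of the band is magnified by
  v_n.\<close>

lemma smoothed_bias2: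
  assumes "0 \<le> h" shows "\<bar>smoothed h x - f x\<bar> \<le> H * m2 * h\<^sup>2"
proof -
  have lin: "has_bochner_integral lborel (\<lambda>z. \<Sum>j\<in>UNIV. gradf x $ j * h * (z $ j * K z)) (\<Sum>j\<in>(UNIV::'n set). gradf x $ j * h * 0)"
    by (intro has_bochner_integral_sum has_bochner_integral_mult_right K_centred)
  have lin_eq: "(\<Sum>j\<in>UNIV. gradf x $ j * h * (z $ j * K z)) = K z * (gradf x \<bullet> (h *\<^sub>R z))" for z
    by (simp add: inner_vec_def sum_distrib_left mult_ac)
  have il: "integrable lborel (\<lambda>z. K z * (gradf x \<bullet> (h *\<^sub>R z)))"
    and vl: "(LINT z|lborel. K z * (gradf x \<bullet> (h *\<^sub>R z))) = 0"
    using lin unfolding lin_eq has_bochner_integral_iff by auto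
  \<comment> \<open>The added integral is zero; it completes the integrand to K times a Taylor
    remainder.\<close>
  have "smoothed h x - f x = (LINT z|lborel. K z * f (x - h *\<^sub>R z)) - (LINT z|lborel. K z * f x)
     + (LINT z|lborel. K z * (gradf x \<bullet> (h *\<^sub>R z)))"
    using K_int vl by (simp add: smoothed_def)
  also have "\<dots> = (LINT z|lborel. (K z * f (x - h *\<^sub>R z) - K z * f x) + K z * (gradf x \<bullet> (h *\<^sub>R z)))"
  proof -
    have i1: "integrable lborel (\<lambda>z. K z * f x)"
      by (intro integrable_mult_left K_integrable)
    show ?thesis
      unfolding Bochner_Integration.integral_add[OF Bochner_Integration.integrable_diff[OF smoothed_integrable i1] il]
        Bochner_Integration.integral_diff[OF smoothed_integrable i1] ..
  qed
  also have "\<bar>\<dots>\<bar> \<le> (LINT z|lborel. H * h\<^sup>2 * ((norm z)\<^sup>2 * K z))"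
    unfolding real_norm_def[symmetric]
  proof (rule Bochner_Integration.integral_norm_bound_integral)
    fix z
    have "\<bar>f (x - h *\<^sub>R z) - f x + gradf x \<bullet> (h *\<^sub>R z)\<bar> \<le> H * (h\<^sup>2 * (norm z)\<^sup>2)"
      using f_Taylor[of x "- (h *\<^sub>R z)"] assms by (simp add: power_mult_distrib)
    then have "K z * \<bar>f (x - h *\<^sub>R z) - f x + gradf x \<bullet> (h *\<^sub>R z)\<bar> \<le> K z * (H * (h\<^sup>2 * (norm z)\<^sup>2))"
      by (intro mult_left_mono K_nonneg)
    also have "K z * \<bar>f (x - h *\<^sub>R z) - f x + gradf x \<bullet> (h *\<^sub>R z)\<bar>
      = \<bar>K z * (f (x - h *\<^sub>R z) - f x + gradf x \<bullet> (h *\<^sub>R z))\<bar>"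
      using K_nonneg[of z] by (simp only: abs_mult abs_of_nonneg)
    finally show "norm (K z * f (x - h *\<^sub>R z) - K z * f x + K z * (gradf x \<bullet> (h *\<^sub>R z))) \<le> H * h\<^sup>2 * ((norm z)\<^sup>2 * K z)"
      by (simp only: right_diff_distrib distrib_left real_norm_def) (simp add: mult_ac)
  qed (intro Bochner_Integration.integrable_diff Bochner_Integration.integrable_add smoothed_integrable integrable_mult_left
       integrable_mult_right K_integrable K_second_moment il)+
  finally show ?thesis by (simp add: m2_def[symmetric]) (simp add: mult_ac)
qed

section \<open>Exponential moments, deviations and oscillation of the estimator\<close>

lemma expectation_kernel:
  assumes h: "0 < h" and j: "1 \<le> j"
  shows "expectation (\<lambda>\<omega>. K ((x - X j \<omega>) /\<^sub>R h)) = h ^ CARD('n) * smoothed h x"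
    and "expectation (\<lambda>\<omega>. (K ((x - X j \<omega>) /\<^sub>R h))\<^sup>2) = h ^ CARD('n) * smoothed_sq h x"
proof -
  have "expectation (\<lambda>\<omega>. K ((x - X j \<omega>) /\<^sub>R h)) = (LINT y|lborel. f y * K ((x - y) /\<^sub>R h))"
    using j by (rule expectation_density[rotated]) simp
  also have "\<dots> = h ^ CARD('n) * smoothed h x"
    using h by (subst lborel_integral_rescale[where h=h and x=x]) (auto simp: smoothed_def mult_ac)
  finally show "expectation (\<lambda>\<omega>. K ((x - X j \<omega>) /\<^sub>R h)) = h ^ CARD('n) * smoothed h x" .
  have "expectation (\<lambda>\<omega>. (K ((x - X j \<omega>) /\<^sub>R h))\<^sup>2) = (LINT y|lborel. f y * (K ((x - y) /\<^sub>R h))\<^sup>2)"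
    using j by (rule expectation_density[rotated]) simp
  also have "\<dots> = h ^ CARD('n) * smoothed_sq h x"
    using h by (subst lborel_integral_rescale[where h=h and x=x]) (auto simp: smoothed_sq_def mult_ac)
  finally show "expectation (\<lambda>\<omega>. (K ((x - X j \<omega>) /\<^sub>R h))\<^sup>2) = h ^ CARD('n) * smoothed_sq h x" .
qed

lemma est_measurable[measurable]: "random_variable borel (\<lambda>\<omega>. est h n \<omega> x)"
proof -
  have [measurable]: "random_variable borel (\<lambda>\<omega>. K ((x - X j \<omega>) /\<^sub>R h))" if "j \<in> {1..n}" for j
  proof -
    have [measurable]: "random_variable borel (X j)" using that X_measurable by simp
    show ?thesis by simp
  qed
  show ?thesis unfolding kernel_estimator_def by measurable
qed

lemma est_minus_smoothed:
  assumes "0 < h" "1 \<le> n"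
  shows "real n * h ^ CARD('n) * (est h n \<omega> x - smoothed h x)
    = (\<Sum>j = 1..n. K ((x - X j \<omega>) /\<^sub>R h) - h ^ CARD('n) * smoothed h x)"
  using assms by (simp add: kernel_estimator_def sum_subtractf right_diff_distrib)

lemma est_mgf:
  assumes h: "0 < h" and n: "1 \<le> n"
  shows "integrable M (\<lambda>\<omega>. exp (l * (real n * h ^ CARD('n) * (est h n \<omega> x - smoothed h x))))"
    and "expectation (\<lambda>\<omega>. exp (l * (real n * h ^ CARD('n) * (est h n \<omega> x - smoothed h x))))
      = expectation (\<lambda>\<omega>. exp (l * (K ((x - X 1 \<omega>) /\<^sub>R h) - expectation (\<lambda>\<omega>. K ((x - X 1 \<omega>) /\<^sub>R h))))) ^ n"
proof -
  have b: "\<bar>K ((x - y) /\<^sub>R h) - h ^ CARD('n) * smoothed h x\<bar> \<le> B + h ^ CARD('n) * smoothed h x" for y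
    using K_nonneg[of "(x - y) /\<^sub>R h"] K_le[of "(x - y) /\<^sub>R h"] smoothed_nonneg[of h x] h
      mult_nonneg_nonneg[of "h ^ CARD('n)" "smoothed h x"] zero_less_power[OF h, of "CARD('n)"] by linarith
  show "integrable M (\<lambda>\<omega>. exp (l * (real n * h ^ CARD('n) * (est h n \<omega> x - smoothed h x))))"
    unfolding est_minus_smoothed[OF h n]
    by (rule mgf_sum(1)[where g="\<lambda>y. K ((x - y) /\<^sub>R h) - h ^ CARD('n) * smoothed h x", OF _ b]) simp
  show "expectation (\<lambda>\<omega>. exp (l * (real n * h ^ CARD('n) * (est h n \<omega> x - smoothed h x))))
      = expectation (\<lambda>\<omega>. exp (l * (K ((x - X 1 \<omega>) /\<^sub>R h) - expectation (\<lambda>\<omega>. K ((x - X 1 \<omega>) /\<^sub>R h))))) ^ n"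
    unfolding est_minus_smoothed[OF h n] expectation_kernel(1)[OF h order_refl]
    by (rule mgf_sum(2)[where g="\<lambda>y. K ((x - y) /\<^sub>R h) - h ^ CARD('n) * smoothed h x", OF _ b]) simp
qed

text \<open>Dropping the squared mean and using 1 + x \<le> exp x turns the n-th power into an
  exponential in n h^d.\<close>

lemma est_mgf_le:
  assumes h: "0 < h" and n: "1 \<le> n" and l: "\<bar>l\<bar> * B \<le> 1"
  shows "expectation (\<lambda>\<omega>. exp (l * (real n * h ^ CARD('n) * (est h n \<omega> x - smoothed h x))))
      \<le> exp (real n * h ^ CARD('n) * (l\<^sup>2 / 2 * (1 + \<bar>l\<bar> * B) * smoothed_sq h x))"
proof -
  have [measurable]: "random_variable borel (X 1)" using X_measurable by simp
  let ?Y = "\<lambda>\<omega>. K ((x - X 1 \<omega>) /\<^sub>R h)"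
  have "expectation (\<lambda>\<omega>. exp (l * (?Y \<omega> - expectation ?Y)))
    \<le> 1 + l\<^sup>2 / 2 * (1 + \<bar>l\<bar> * B) * (expectation (\<lambda>\<omega>. (?Y \<omega>)\<^sup>2) - (expectation ?Y)\<^sup>2)"
    by (intro centred_mgf_le K_nonneg K_le l) measurable
  also have "\<dots> \<le> 1 + l\<^sup>2 / 2 * (1 + \<bar>l\<bar> * B) * expectation (\<lambda>\<omega>. (?Y \<omega>)\<^sup>2)"
    using B_pos by (intro add_left_mono mult_left_mono) auto
  also have "\<dots> \<le> exp (l\<^sup>2 / 2 * (1 + \<bar>l\<bar> * B) * expectation (\<lambda>\<omega>. (?Y \<omega>)\<^sup>2))"
    by (rule exp_ge_add_one_self)
  finally have "expectation (\<lambda>\<omega>. exp (l * (?Y \<omega> - expectation ?Y))) ^ n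
     \<le> exp (l\<^sup>2 / 2 * (1 + \<bar>l\<bar> * B) * expectation (\<lambda>\<omega>. (?Y \<omega>)\<^sup>2)) ^ n"
    by (intro power_mono Bochner_Integration.integral_nonneg) auto
  then show ?thesis
    unfolding est_mgf(2)[OF h n] expectation_kernel(2)[OF h order_refl] exp_of_nat_mult[symmetric]
    by (simp add: mult_ac)
qed

text \<open>A lower bound has to keep the squared mean; relative to the second moment it carries an
  extra factor h^d and disappears in the limit. The bounds on l and \<open>pos\<close> make the base
  at least 1, so the n-th power is monotone.\<close>

lemma est_mgf_ge:
  assumes h: "0 < h" and n: "1 \<le> n" and l: "\<bar>l\<bar> * B \<le> 1"
    and pos: "h ^ CARD('n) * (smoothed h x)\<^sup>2 \<le> smoothed_sq h x"
  shows "(1 + h ^ CARD('n) * (l\<^sup>2 / 2 * (1 - \<bar>l\<bar> * B) * (smoothed_sq h x - h ^ CARD('n) * (smoothed h x)\<^sup>2))) ^ n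
      \<le> expectation (\<lambda>\<omega>. exp (l * (real n * h ^ CARD('n) * (est h n \<omega> x - smoothed h x))))"
proof -
  have [measurable]: "random_variable borel (X 1)" using X_measurable by simp
  let ?Y = "\<lambda>\<omega>. K ((x - X 1 \<omega>) /\<^sub>R h)"
  have "1 + h ^ CARD('n) * (l\<^sup>2 / 2 * (1 - \<bar>l\<bar> * B) * (smoothed_sq h x - h ^ CARD('n) * (smoothed h x)\<^sup>2))
    = 1 + l\<^sup>2 / 2 * (1 - \<bar>l\<bar> * B) * (expectation (\<lambda>\<omega>. (?Y \<omega>)\<^sup>2) - (expectation ?Y)\<^sup>2)"
    unfolding expectation_kernel[OF h order_refl] by (simp add: power2_eq_square algebra_simps)
  also have "\<dots> \<le> expectation (\<lambda>\<omega>. exp (l * (?Y \<omega> - expectation ?Y)))"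
    by (intro centred_mgf_ge K_nonneg K_le l) measurable
  finally show ?thesis
    unfolding est_mgf(2)[OF h n] 
    by (intro power_mono) (use l pos h in auto)
qed

text \<open>Chernoff's bound for both signs of the tilt. The parameter l stays free because it is
  used in two regimes: constant for deviations of fixed size, and of order 1 / v_n for deviations of
  order 1 / v_n.\<close>

lemma est_deviation:
  assumes h: "0 < h" and n: "1 \<le> n" and l: "0 \<le> l" "l * B \<le> 1"
  shows "prob {\<omega> \<in> space M. \<tau> \<le> \<bar>est h n \<omega> x - smoothed h x\<bar>}
    \<le> 2 * exp (- (real n * h ^ CARD('n) * (l * \<tau> - l\<^sup>2 / 2 * (1 + l * B) * smoothed_sq h x)))"
proof -
  define N where "N = real n * h ^ CARD('n)"
  have N: "0 \<le> N" using h by (simp add: N_def)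
  define D where "D \<omega> = est h n \<omega> x - smoothed h x" for \<omega>
  have [measurable]: "random_variable borel D" unfolding D_def by simp
  have tail: "prob {\<omega> \<in> space M. exp (l * N * \<tau>) \<le> exp (l' * (N * D \<omega>))}
    \<le> exp (N * (l\<^sup>2 / 2 * (1 + l * B) * smoothed_sq h x)) / exp (l * N * \<tau>)" if "\<bar>l'\<bar> = l" for l'
  proof -
    have "prob {\<omega> \<in> space M. exp (l * N * \<tau>) \<le> exp (l' * (N * D \<omega>))}
      \<le> expectation (\<lambda>\<omega>. exp (l' * (N * D \<omega>))) / exp (l * N * \<tau>)"
      using est_mgf(1)[OF h n, of l' x] 
      by (intro integral_Markov_inequality_measure[where A="{}"]) (auto simp: N_def D_def)
    also have "\<dots> \<le> exp (N * (l\<^sup>2 / 2 * (1 + l * B) * smoothed_sq h x)) / exp (l * N * \<tau>)"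
    proof -
      have "l'\<^sup>2 = l\<^sup>2" using that by (metis power2_abs)
      then show ?thesis
        using est_mgf_le[OF h n, of l' x] that l by (intro divide_right_mono) (auto simp: N_def D_def)
    qed
    finally show ?thesis .
  qed
  have "prob {\<omega> \<in> space M. \<tau> \<le> \<bar>D \<omega>\<bar>} \<le> prob ({\<omega> \<in> space M. exp (l * N * \<tau>) \<le> exp (l * (N * D \<omega>))}
      \<union> {\<omega> \<in> space M. exp (l * N * \<tau>) \<le> exp (- l * (N * D \<omega>))})"
  proof (rule finite_measure_mono)
    show "{\<omega> \<in> space M. \<tau> \<le> \<bar>D \<omega>\<bar>} \<subseteq> {\<omega> \<in> space M. exp (l * N * \<tau>) \<le> exp (l * (N * D \<omega>))}
      \<union> {\<omega> \<in> space M. exp (l * N * \<tau>) \<le> exp (- l * (N * D \<omega>))}"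
    proof
      fix \<omega> assume a: "\<omega> \<in> {\<omega> \<in> space M. \<tau> \<le> \<bar>D \<omega>\<bar>}"
      then have "\<tau> \<le> D \<omega> \<or> \<tau> \<le> - D \<omega>" by auto
      then have "l * N * \<tau> \<le> l * N * D \<omega> \<or> l * N * \<tau> \<le> l * N * (- D \<omega>)"
        using l N by (meson mult_left_mono mult_nonneg_nonneg)
      then show "\<omega> \<in> {\<omega> \<in> space M. exp (l * N * \<tau>) \<le> exp (l * (N * D \<omega>))}
      \<union> {\<omega> \<in> space M. exp (l * N * \<tau>) \<le> exp (- l * (N * D \<omega>))}"
        using a by (auto simp: mult_ac)
    qed
  qed measurable
  also have "\<dots> \<le> prob {\<omega> \<in> space M. exp (l * N * \<tau>) \<le> exp (l * (N * D \<omega>))}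
      + prob {\<omega> \<in> space M. exp (l * N * \<tau>) \<le> exp (- l * (N * D \<omega>))}"
    by (intro measure_Un_le) measurable
  also have "\<dots> \<le> exp (N * (l\<^sup>2 / 2 * (1 + l * B) * smoothed_sq h x)) / exp (l * N * \<tau>)
     + exp (N * (l\<^sup>2 / 2 * (1 + l * B) * smoothed_sq h x)) / exp (l * N * \<tau>)"
    using l by (intro add_mono tail) auto
  also have "\<dots> = 2 * exp (- (N * (l * \<tau> - l\<^sup>2 / 2 * (1 + l * B) * smoothed_sq h x)))"
    by (simp add: exp_diff[symmetric] algebra_simps)
  finally show ?thesis unfolding D_def N_def .
qed

text \<open>The bound holds for every outcome, since each summand inherits the modulus of K. The
  loss of h to the power - d is only polynomial, so a fine enough mesh compensates for it.\<close>

lemma est_Hoelder: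
  assumes h: "0 < h"
  shows "\<bar>est h n \<omega> x - est h n \<omega> y\<bar> \<le> L * (norm (x - y) / h) powr \<alpha> / h ^ CARD('n)"
\<comment> \<open>For n = 0 the estimator is an empty sum, hence 0.\<close>
proof (cases "n = 0")
  case True
  then show ?thesis using consts_nonneg h by (simp add: kernel_estimator_def)
next
  case False
  have *: "\<bar>K ((x - u) /\<^sub>R h) - K ((y - u) /\<^sub>R h)\<bar> \<le> L * (norm (x - y) / h) powr \<alpha>" for u
  proof -
    have "(x - u) /\<^sub>R h - (y - u) /\<^sub>R h = (x - y) /\<^sub>R h"
      by (simp add: scaleR_diff_right)
    then show ?thesis using K_Hoelder[of "(x - u) /\<^sub>R h" "(y - u) /\<^sub>R h"] h by (simp add: divide_inverse_commute)
  qed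
  have "\<bar>est h n \<omega> x - est h n \<omega> y\<bar>
    = 1 / (real n * h ^ CARD('n)) * \<bar>\<Sum>j = 1..n. K ((x - X j \<omega>) /\<^sub>R h) - K ((y - X j \<omega>) /\<^sub>R h)\<bar>"
    using h by (simp add: kernel_estimator_def sum_subtractf diff_divide_distrib[symmetric] abs_mult)
  also have "\<dots> \<le> 1 / (real n * h ^ CARD('n)) * (\<Sum>j = 1..n. L * (norm (x - y) / h) powr \<alpha>)"
    using h by (intro mult_left_mono order_trans[OF sum_abs] sum_mono *) auto
  also have "\<dots> = L * (norm (x - y) / h) powr \<alpha> / h ^ CARD('n)"
    using False by simp
  finally show ?thesis .
qed

lemma est_continuous: "continuous_on UNIV (est h n \<omega>)"
  unfolding kernel_estimator_def[abs_def]
  by (intro continuous_intros continuous_on_compose2[OF K_continuous]) auto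

end

section \<open>Nets and Taylor bounds\<close>

text \<open>Space is cut into cubes of side \<rho> / d and one point of C is kept for each cube that
  meets C. The net has to lie inside C, because only there is f bounded away from zero.\<close>

lemma finite_net_exists:
  fixes C :: "(real ^ 'n) set"
  assumes "bounded C"
  obtains c where "1 \<le> c" "\<And>\<rho>. 0 < \<rho> \<Longrightarrow> \<rho> \<le> 1 \<Longrightarrow>
    \<exists>T\<subseteq>C. finite T \<and> real (card T) \<le> c * (1 / \<rho>) ^ CARD('n) \<and> (\<forall>x\<in>C. \<exists>y\<in>T. norm (x - y) \<le> \<rho>)"
proof -
  let ?d = "real CARD('n)"
  obtain R where R: "0 < R" "\<And>x. x \<in> C \<Longrightarrow> norm x \<le> R"
    using assms unfolding bounded_pos by blast
  \<comment> \<open>A coordinate takes at most 2 m + 1 \<le> 2 R d / \<rho> + 3 values, which is at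
    most (2 R d + 3) / \<rho> because \<rho> \<le> 1.\<close>
  define c where "c = (2 * R * ?d + 3) ^ CARD('n)"
  have d: "0 < ?d" by simp
  have "1 \<le> c" unfolding c_def using R d by (intro one_le_power) auto
  moreover have "\<exists>T\<subseteq>C. finite T \<and> real (card T) \<le> c * (1 / \<rho>) ^ CARD('n) \<and> (\<forall>x\<in>C. \<exists>y\<in>T. norm (x - y) \<le> \<rho>)"
    if \<rho>: "0 < \<rho>" "\<rho> \<le> 1" for \<rho>
  proof -
    \<comment> \<open>The reciprocal of the side: two points of one cube differ by at most \<rho> /
      d in each coordinate, hence by at most \<rho> in the l1 norm, which dominates the Euclidean
      one.\<close>
    define q where "q = ?d / \<rho>"
    have q: "0 < q" unfolding q_def using d \<rho> by (intro divide_pos_pos)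
    define \<phi> :: "real ^ 'n \<Rightarrow> 'n \<Rightarrow> int" where "\<phi> x i = \<lfloor>x $ i * q\<rfloor>" for x i
    define m where "m = \<lceil>R * q\<rceil>"
    have "0 < R * q" using R q by simp
    then have m0: "0 \<le> m" unfolding m_def by linarith
    define P where "P = (PiE UNIV (\<lambda>_::'n. {- m..m}))"
    have finP: "finite P" unfolding P_def by (intro finite_PiE) auto
    have sub: "\<phi> ` C \<subseteq> P"
    proof
      fix k assume "k \<in> \<phi> ` C"
      then obtain x where x: "x \<in> C" "k = \<phi> x" by blast
      have "\<phi> x i \<in> {- m..m}" for i
      proof -
        have "\<bar>x $ i\<bar> \<le> R" using R(2)[OF x(1)] component_le_norm_cart[of x i] by linarith
        then have "\<bar>x $ i\<bar> * q \<le> R * q" using q by (intro mult_right_mono) auto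
        moreover have "\<bar>x $ i * q\<bar> = \<bar>x $ i\<bar> * q" using q by (simp add: abs_mult)
        ultimately have "\<bar>x $ i * q\<bar> \<le> of_int m" unfolding m_def by linarith
        then show ?thesis using floor_mono[of "x $ i * q" "of_int m"]
          unfolding \<phi>_def by (auto simp: le_floor_iff abs_le_iff)
      qed
      then show "k \<in> P" using x by (auto simp: P_def)
    qed
    define T where "T = inv_into C \<phi> ` \<phi> ` C"
    have T: "T \<subseteq> C" unfolding T_def by (auto intro: inv_into_into)
    have fin: "finite T" unfolding T_def using finite_subset[OF sub finP] by simp
    have "card T \<le> card P"
      unfolding T_def using card_image_le[OF finite_subset[OF sub finP]] card_mono[OF finP sub] order_trans by blast
    also have "card P = nat (2 * m + 1) ^ CARD('n)"
      unfolding P_def by (subst card_PiE) (auto simp: add.commute)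
    finally have "real (card T) \<le> real (nat (2 * m + 1)) ^ CARD('n)"
      by (metis of_nat_le_iff of_nat_power)
    also have "real (nat (2 * m + 1)) = 2 * of_int m + 1" using m0 by simp
    also have "(2 * of_int m + 1 :: real) ^ CARD('n) \<le> ((2 * R * ?d + 3) * (1 / \<rho>)) ^ CARD('n)"
    proof (rule power_mono)
      have "of_int m \<le> R * q + 1" unfolding m_def by linarith
      moreover have "3 \<le> 3 / \<rho>" using \<rho> by (simp add: field_simps)
      ultimately have "2 * of_int m + 1 \<le> 2 * (R * q) + 3 / \<rho>" by linarith
      then show "2 * of_int m + 1 \<le> (2 * R * ?d + 3) * (1 / \<rho>)" by (simp add: q_def add_divide_distrib)
    qed (use m0 in simp)
    finally have card: "real (card T) \<le> c * (1 / \<rho>) ^ CARD('n)"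
      unfolding c_def power_mult_distrib .
    have net: "\<exists>y\<in>T. norm (x - y) \<le> \<rho>" if x: "x \<in> C" for x
    proof (intro bexI)
      let ?y = "inv_into C \<phi> (\<phi> x)"
      show "?y \<in> T" using x by (auto simp: T_def)
      have eq: "\<phi> ?y = \<phi> x" using x by (intro f_inv_into_f) auto
      have "\<bar>(x - ?y) $ i\<bar> \<le> \<rho> / ?d" for i
      proof -
        have "\<lfloor>?y $ i * q\<rfloor> = \<lfloor>x $ i * q\<rfloor>" using fun_cong[OF eq, of i] by (simp add: \<phi>_def)
        then have "\<bar>x $ i * q - ?y $ i * q\<bar> \<le> 1" by linarith
        moreover have "x $ i * q - ?y $ i * q = (x - ?y) $ i * q"
          by (simp add: left_diff_distrib)
        ultimately have "\<bar>(x - ?y) $ i\<bar> * q \<le> 1" using q by (simp add: abs_mult)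
        then show ?thesis using d \<rho> unfolding q_def by (simp add: field_simps)
      qed
      then have "(\<Sum>i\<in>UNIV. \<bar>(x - ?y) $ i\<bar>) \<le> (\<Sum>i\<in>(UNIV :: 'n set). \<rho> / ?d)" by (intro sum_mono)
      then show "norm (x - ?y) \<le> \<rho>" using norm_le_l1_cart[of "x - ?y"] by simp
    qed
    show ?thesis using T fin card net by blast
  qed
  ultimately show ?thesis using that by blast
qed

text \<open>By the mean value inequality the gradient has Lipschitz constant H. A second use of it,
  for f minus its linear part on the ball of radius |u|, gives the remainder without the factor
  1/2.\<close>

lemma gradient_Taylor_bound:
  fixes f :: "'a::euclidean_space \<Rightarrow> real" and D2f :: "'a \<Rightarrow> 'a \<Rightarrow>\<^sub>L 'a"
  assumes f_grad: "\<And>x. GDERIV f x :> gradf x"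
    and f_hess: "\<And>x. (gradf has_derivative blinfun_apply (D2f x)) (at x)"
    and H: "\<And>x. norm (D2f x) \<le> H"
  shows "\<bar>f (x + u) - f x - gradf x \<bullet> u\<bar> \<le> H * (norm u)\<^sup>2"
proof -
  have Lip: "norm (gradf y - gradf x) \<le> H * norm (y - x)" for y
    using f_hess H by (intro differentiable_bound[of UNIV gradf "\<lambda>x. blinfun_apply (D2f x)"])
      (auto simp: norm_blinfun.rep_eq[symmetric])
  have "norm (f (x + u) - f x - (\<lambda>v. v \<bullet> gradf x) (x + u - x)) \<le> norm (x + u - x) * (H * norm u)"
  proof (rule differentiable_bound_linearization[where S="cball x (norm u)" and f'="\<lambda>y v. v \<bullet> gradf y" and ?x0.0=x])
    show "x + t *\<^sub>R (x + u - x) \<in> cball x (norm u)" if "t \<in> {0..1}" for t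
      using that by (auto simp: dist_norm intro: mult_left_le_one_le)
    show "(f has_derivative (\<lambda>v. v \<bullet> gradf y)) (at y within cball x (norm u))" for y
      using f_grad[of y] unfolding gderiv_def by (rule has_derivative_at_withinI)
    show "onorm ((\<lambda>v. v \<bullet> gradf y) - (\<lambda>v. v \<bullet> gradf x)) \<le> H * norm u" if "y \<in> cball x (norm u)" for y
      unfolding fun_diff_def
    proof (rule onorm_le)
      fix v
      have "norm (v \<bullet> gradf y - v \<bullet> gradf x) \<le> norm v * norm (gradf y - gradf x)"
        by (simp add: inner_diff_right[symmetric] Cauchy_Schwarz_ineq2)
      also have "\<dots> \<le> norm v * (H * norm u)"
      proof (rule mult_left_mono)
        have "0 \<le> H" by (rule order_trans[OF norm_ge_zero H])
        then have "H * norm (y - x) \<le> H * norm u"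
          using that by (intro mult_left_mono) (auto simp: dist_norm norm_minus_commute)
        then show "norm (gradf y - gradf x) \<le> H * norm u" by (rule order_trans[OF Lip])
      qed simp
      finally show "norm (v \<bullet> gradf y - v \<bullet> gradf x) \<le> H * norm u * norm v" by (simp add: mult_ac)
    qed
  qed simp
  then show ?thesis by (simp add: power2_eq_square inner_commute mult_ac)
qed

lemma gradient_Lipschitz_bound:
  fixes f :: "'a::euclidean_space \<Rightarrow> real"
  assumes f_grad: "\<And>x. GDERIV f x :> gradf x" and G: "\<And>x. norm (gradf x) \<le> G"
  shows "\<bar>f x - f y\<bar> \<le> G * norm (x - y)"
proof -
  have "norm (f x - f y) \<le> G * norm (x - y)"
  proof (rule differentiable_bound[of UNIV f "\<lambda>y v. v \<bullet> gradf y"])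
    show "(f has_derivative (\<lambda>v. v \<bullet> gradf y)) (at y within UNIV)" for y
      using f_grad[of y] unfolding gderiv_def .
    show "onorm (\<lambda>v. v \<bullet> gradf y) \<le> G" for y
    proof (rule onorm_le)
      fix v
      have "norm (v \<bullet> gradf y) \<le> norm v * norm (gradf y)" by (simp add: Cauchy_Schwarz_ineq2)
      also have "\<dots> \<le> norm v * G" using G by (intro mult_left_mono) auto
      finally show "norm (v \<bullet> gradf y) \<le> G * norm v" by (simp add: mult_ac)
    qed
  qed auto
  then show ?thesis by simp
qed

section \<open>Reduction to a net\<close>

context kernel_sample
begin

definition miss :: "real \<Rightarrow> real \<Rightarrow> real \<Rightarrow> real \<Rightarrow> (real ^ 'n) set \<Rightarrow> nat \<Rightarrow> 'w set"
  where "miss hs h v \<delta> C n = {\<omega> \<in> space M. \<exists>x\<in>C. \<delta> * (sqrt (est h n \<omega> x * \<kappa>) / v) < \<bar>f x - est hs n \<omega> x\<bar>}"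

text \<open>For a fixed outcome both sides of the strict inequality are continuous in x, so the
  points where it holds form an open set. It therefore meets C exactly when it meets a countable
  dense subset of C.\<close>

lemma miss_measurable[measurable]: "miss hs h v \<delta> C n \<in> sets M"
proof -
  obtain D where D: "countable D" "D \<subseteq> C" "C \<subseteq> closure D"
    by (rule separable)
  have "miss hs h v \<delta> C n = (\<Union>x\<in>D. {\<omega> \<in> space M. \<delta> * (sqrt (est h n \<omega> x * \<kappa>) / v) < \<bar>f x - est hs n \<omega> x\<bar>})" (is "_ = ?U")
  proof (rule set_eqI)
    fix \<omega>
    let ?A = "{x. \<delta> * (sqrt (est h n \<omega> x * \<kappa>) / v) < \<bar>f x - est hs n \<omega> x\<bar>}"
    have "open ?A"
      \<comment> \<open>Multiplication by the constant \<open>inverse v\<close> is continuous even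
        for v = 0, whereas the continuity rule for quotients asks for a nonzero denominator.\<close>
      unfolding divide_inverse
      by (intro open_Collect_less continuous_intros f_continuous est_continuous)
    then have "?A \<inter> closure D \<noteq> {} \<longleftrightarrow> ?A \<inter> D \<noteq> {}"
      using open_Int_closure_eq_empty by blast
    then show "\<omega> \<in> miss hs h v \<delta> C n \<longleftrightarrow> \<omega> \<in> ?U"
      using D unfolding miss_def by blast
  qed
  also have "\<dots> \<in> sets M"
    using D(1) by (intro sets.countable_UN'') measurable
  finally show ?thesis .
qed

lemma est_fixed_deviation:
  assumes "0 < \<eta>"
  obtains \<gamma> where "0 < \<gamma>" "\<And>h n x. 0 < h \<Longrightarrow> 1 \<le> n \<Longrightarrow>
    prob {\<omega> \<in> space M. \<eta> \<le> \<bar>est h n \<omega> x - smoothed h x\<bar>} \<le> 2 * exp (- (\<gamma> * (real n * h ^ CARD('n))))"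
proof -
  \<comment> \<open>Q bounds \<open>smoothed_sq\<close> and is positive even if F = 0. With l Q
    \<le> \<eta> / 2 the quadratic term takes at most half of l \<eta>, whence \<gamma> = l \<eta> /
    2.\<close>
  define Q where "Q = F * \<kappa> + 1"
  have Q: "0 < Q" using F_nonneg kappa_pos by (simp add: Q_def add_nonneg_pos)
  define l where "l = min (1 / B) (\<eta> / (2 * Q))"
  have l: "0 < l" "l * B \<le> 1" "l * Q \<le> \<eta> / 2"
    using B_pos Q assms by (auto simp: l_def field_simps min_def)
  have "prob {\<omega> \<in> space M. \<eta> \<le> \<bar>est h n \<omega> x - smoothed h x\<bar>} \<le> 2 * exp (- (l * \<eta> / 2 * (real n * h ^ CARD('n))))"
    if h: "0 < h" and n: "1 \<le> n" for h n x
  proof -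
    have "l\<^sup>2 / 2 * (1 + l * B) * smoothed_sq h x \<le> l\<^sup>2 / 2 * 2 * Q"
      using l smoothed_sq_le[of h x] smoothed_sq_nonneg[of h x] B_pos Q
      by (intro mult_mono mult_nonneg_nonneg add_nonneg_nonneg) (auto simp: Q_def)
    also have "\<dots> = l * (l * Q)" by (simp add: power2_eq_square)
    also have "\<dots> \<le> l * (\<eta> / 2)" using l by (intro mult_left_mono) auto
    finally have "l * \<eta> / 2 \<le> l * \<eta> - l\<^sup>2 / 2 * (1 + l * B) * smoothed_sq h x" by (simp add: mult.commute[of \<eta> l])
    then have "l * \<eta> / 2 * (real n * h ^ CARD('n))
       \<le> (real n * h ^ CARD('n)) * (l * \<eta> - l\<^sup>2 / 2 * (1 + l * B) * smoothed_sq h x)"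
      using h by (subst mult.commute) (intro mult_left_mono, auto)
    then show ?thesis
      using est_deviation[OF h n, of l \<eta> x] l by (smt (verit) exp_le_cancel_iff)
  qed
  with l assms show ?thesis by (intro that[of "l * \<eta> / 2"]) auto
qed

text \<open>One mesh exponent p serves all bandwidths b \<ge> r^q: choosing k with k \<alpha> \<ge>
  q d + 3, the Hoelder factor r^(q d) cancels the worst case of 1 / b^d and r^3 remains. The power 3
  is chosen because v r^3 = (v r^2) r, which vanishes for r = hs_n by \<open>rate2\<close>.\<close>

lemma est_Hoelder_net:
  fixes q :: nat
  obtains p :: nat where "3 \<le> p" "\<And>r b x y n \<omega>. 0 < r \<Longrightarrow> r < 1 \<Longrightarrow> r ^ q \<le> b \<Longrightarrow>
    norm (x - y) \<le> r ^ p \<Longrightarrow> \<bar>est b n \<omega> x - est b n \<omega> y\<bar> \<le> L * r ^ 3"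
proof -
  let ?d = "CARD('n)"
  obtain k :: nat where k: "real (q * ?d + 3) / \<alpha> \<le> real k" using real_arch_simple by blast
  then have k': "real (q * ?d + 3) \<le> real k * \<alpha>" using \<alpha>_pos by (simp add: field_simps)
  have "\<bar>est b n \<omega> x - est b n \<omega> y\<bar> \<le> L * r ^ 3"
    if r: "0 < r" "r < 1" and b: "r ^ q \<le> b" and xy: "norm (x - y) \<le> r ^ (q + k + 3)" for r b x y n \<omega>
  proof -
    have b0: "0 < b" using b zero_less_power[OF r(1), of q] by linarith
    have "norm (x - y) / b \<le> r ^ (q + k + 3) / r ^ q"
      using xy b r by (intro frac_le) auto
    also have "\<dots> = r ^ (k + 3)" using r by (simp add: power_add)
    also have "\<dots> \<le> r ^ k" using r by (intro power_decreasing) auto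
    also have "\<dots> = r powr k" using r by (simp add: powr_realpow)
    finally have "(norm (x - y) / b) powr \<alpha> \<le> (r powr k) powr \<alpha>"
      using \<alpha>_pos b0 by (intro powr_mono2) auto
    also have "\<dots> \<le> r powr (real (q * ?d + 3))"
      unfolding powr_powr using k' r by (intro powr_mono') auto
    also have "\<dots> = r ^ (q * ?d) * r ^ 3" using r by (subst powr_realpow) (auto simp: power_add)
    finally have *: "(norm (x - y) / b) powr \<alpha> \<le> r ^ (q * ?d) * r ^ 3" .
    have "L * (norm (x - y) / b) powr \<alpha> / b ^ ?d \<le> L * (r ^ (q * ?d) * r ^ 3) / (r ^ q) ^ ?d"
      using * b r consts_nonneg b0 by (intro frac_le mult_left_mono power_mono) auto
    also have "\<dots> = L * r ^ 3" using r by (simp add: power_mult)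
    finally show ?thesis using est_Hoelder[OF b0, of \<omega> n x y] by linarith
  qed
  then show ?thesis by (intro that[of "q + k + 3"]) auto
qed

text \<open>A miss at x is charged to a nearby net point y. If neither event occurs at y, then the
  width estimator at x is at least f(y) - 2 \<epsilon>: one \<epsilon> for its deviation, one for
  bias and oscillation. The error of the centre then fits into the band, \<eta> / v being reserved
  for its bias and the passage from y to x.\<close>

lemma miss_subset_net:
  assumes hs: "0 < hs" and h: "0 < h" and v: "0 < v" and \<delta>: "0 \<le> \<delta>"
    and T: "\<And>x. x \<in> C \<Longrightarrow> \<exists>y\<in>T. norm (x - y) \<le> \<rho>"
    and osc: "\<And>n \<omega> x y. norm (x - y) \<le> \<rho> \<Longrightarrow> \<bar>est hs n \<omega> x - est hs n \<omega> y\<bar> \<le> e"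
      "\<And>n \<omega> x y. norm (x - y) \<le> \<rho> \<Longrightarrow> \<bar>est h n \<omega> x - est h n \<omega> y\<bar> \<le> e"
    and small: "G * m1 * h + e \<le> \<epsilon>" "v * (e + G * \<rho> + H * m2 * hs\<^sup>2) \<le> \<eta>"
  shows "miss hs h v \<delta> C n \<subseteq> (\<Union>y\<in>T. {\<omega> \<in> space M. \<epsilon> \<le> \<bar>est h n \<omega> y - smoothed h y\<bar>}
     \<union> {\<omega> \<in> space M. (\<delta> * sqrt ((f y - 2 * \<epsilon>) * \<kappa>) - \<eta>) / v \<le> \<bar>est hs n \<omega> y - smoothed hs y\<bar>})" (is "_ \<subseteq> ?R")
proof
  fix \<omega> assume w: "\<omega> \<in> miss hs h v \<delta> C n"
  then obtain x where x: "x \<in> C" "\<delta> * (sqrt (est h n \<omega> x * \<kappa>) / v) < \<bar>f x - est hs n \<omega> x\<bar>" "\<omega> \<in> space M"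
    unfolding miss_def by blast
  obtain y where y: "y \<in> T" "norm (x - y) \<le> \<rho>" using T[OF x(1)] by blast
  show "\<omega> \<in> ?R"
  proof (rule ccontr)
    assume "\<omega> \<notin> ?R"
    with y x have dev: "\<bar>est h n \<omega> y - smoothed h y\<bar> < \<epsilon>"
      "\<bar>est hs n \<omega> y - smoothed hs y\<bar> < (\<delta> * sqrt ((f y - 2 * \<epsilon>) * \<kappa>) - \<eta>) / v" by auto
    have "f y - 2 * \<epsilon> \<le> est h n \<omega> x"
      using osc(2)[OF y(2), of \<omega> n] smoothed_bias1[of h y] dev(1) small(1) h by linarith
    then have "sqrt ((f y - 2 * \<epsilon>) * \<kappa>) \<le> sqrt (est h n \<omega> x * \<kappa>)"
      using kappa_pos by (intro real_sqrt_le_mono mult_right_mono) auto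
    then have s: "\<delta> * sqrt ((f y - 2 * \<epsilon>) * \<kappa>) / v \<le> \<delta> * (sqrt (est h n \<omega> x * \<kappa>) / v)"
      using \<delta> v by (simp add: divide_right_mono mult_left_mono)
    have fxy: "\<bar>f x - f y\<bar> \<le> G * \<rho>"
      using f_Lipschitz[of x y] mult_left_mono[OF y(2) consts_nonneg(1)] by linarith
    have "e + G * \<rho> + H * m2 * hs\<^sup>2 \<le> \<eta> / v"
      using small(2) v by (simp add: pos_le_divide_eq mult.commute)
    then have "\<bar>f x - est hs n \<omega> x\<bar> \<le> \<delta> * sqrt ((f y - 2 * \<epsilon>) * \<kappa>) / v"
      using fxy osc(1)[OF y(2), of \<omega> n] smoothed_bias2[of hs y] dev(2) hs
      unfolding diff_divide_distrib by linarith
    then show False using s x(2) by linarith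
  qed
qed

end

section \<open>Consequences of the rate conditions\<close>

locale kernel_rates = kernel_sample M X f K gradf B F G H L \<alpha>
  for M :: "'w measure" and X :: "nat \<Rightarrow> 'w \<Rightarrow> real ^ 'n" and f K gradf B F G H L \<alpha> +
  fixes h hs v :: "nat \<Rightarrow> real" and C :: "(real ^ 'n) set" and c \<delta> :: real
  assumes h_pos: "\<And>n. 1 \<le> n \<Longrightarrow> 0 < h n" and h_lim: "h \<longlonglongrightarrow> 0"
    and hs_pos: "\<And>n. 1 \<le> n \<Longrightarrow> 0 < hs n" and hs_lim: "hs \<longlonglongrightarrow> 0"
    and v_pos: "\<And>n. 1 \<le> n \<Longrightarrow> 0 < v n" and v_lim: "filterlim v at_top sequentially"
    and C_nonempty: "C \<noteq> {}" and C_bounded: "bounded C"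
    and c_pos: "0 < c" and f_ge: "\<And>x. x \<in> C \<Longrightarrow> c \<le> f x"
    and rate1: "filterlim (\<lambda>n. real n * hs n ^ CARD('n) / ((v n)\<^sup>2 * ln (1 / hs n))) at_top sequentially"
    and rate2: "(\<lambda>n. v n * (hs n)\<^sup>2) \<longlonglongrightarrow> 0"
    and rate3: "filterlim (\<lambda>n. (v n)\<^sup>2 * h n ^ CARD('n) / hs n ^ CARD('n)) at_top sequentially"
    and \<delta>_pos: "0 < \<delta>"
begin

definition speed :: "nat \<Rightarrow> real"
  where "speed n = real n * hs n ^ CARD('n) / (v n)\<^sup>2"

abbreviation miss_prob :: "nat \<Rightarrow> real"
  where "miss_prob n \<equiv> prob (miss (hs n) (h n) (v n) \<delta> C n)"

lemma ln_hs: "filterlim (\<lambda>n. ln (1 / hs n)) at_top sequentially"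
proof -
  have "filterlim hs (at_right 0) sequentially"
    unfolding filterlim_at
  proof
    show "\<forall>\<^sub>F n in sequentially. hs n \<in> {0<..} \<and> hs n \<noteq> 0"
      using eventually_ge_at_top[of 1] by eventually_elim (use hs_pos in force)
  qed (rule hs_lim)
  then have "filterlim (\<lambda>n. inverse (hs n)) at_top sequentially"
    by (rule filterlim_compose[OF filterlim_inverse_at_top_right])
  then show ?thesis
    unfolding inverse_eq_divide by (rule filterlim_compose[OF ln_at_top])
qed

lemma basic_eventually:
  "\<forall>\<^sub>F n in sequentially. 1 \<le> n \<and> 0 < hs n \<and> hs n < 1 \<and> 0 < h n \<and> 0 < v n \<and> v n * (hs n)\<^sup>2 \<le> 1
    \<and> 1 \<le> (v n)\<^sup>2 * h n ^ CARD('n) / hs n ^ CARD('n)"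
proof -
  have "\<forall>\<^sub>F n in sequentially. hs n < 1" by (rule order_tendstoD[OF hs_lim]) simp
  moreover have "\<forall>\<^sub>F n in sequentially. v n * (hs n)\<^sup>2 < 1" by (rule order_tendstoD[OF rate2]) simp
  moreover have "\<forall>\<^sub>F n in sequentially. 1 \<le> (v n)\<^sup>2 * h n ^ CARD('n) / hs n ^ CARD('n)"
    using rate3 unfolding filterlim_at_top by blast
  ultimately show ?thesis using eventually_ge_at_top[of 1]
    by eventually_elim (use hs_pos h_pos v_pos in auto)
qed

text \<open>This is \<open>rate1\<close> cleared of its denominator. With Z arbitrary, every fixed
  power of 1 / hs_n becomes exp (o (speed n)).\<close>

lemma speed_ge_ln: "\<forall>\<^sub>F n in sequentially. Z * ln (1 / hs n) \<le> speed n"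
proof -
  have "\<forall>\<^sub>F n in sequentially. Z \<le> real n * hs n ^ CARD('n) / ((v n)\<^sup>2 * ln (1 / hs n))"
    using rate1 unfolding filterlim_at_top by blast
  moreover have "\<forall>\<^sub>F n in sequentially. 1 \<le> ln (1 / hs n)"
    using ln_hs unfolding filterlim_at_top by blast
  ultimately show ?thesis using basic_eventually
  proof eventually_elim
    case (elim n)
    then show ?case by (simp add: speed_def field_simps)
  qed
qed

lemma speed_at_top: "filterlim speed at_top sequentially"
proof (rule filterlim_at_top_mono[OF ln_hs])
  show "\<forall>\<^sub>F n in sequentially. ln (1 / hs n) \<le> speed n" using speed_ge_ln[of 1] by simp
qed

lemma speed_ge: "\<forall>\<^sub>F n in sequentially. Z \<le> speed n"
  using speed_at_top unfolding filterlim_at_top by blast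

lemma h_ge: "\<forall>\<^sub>F n in sequentially. hs n ^ (CARD('n) + 4) \<le> h n"
  using basic_eventually
proof eventually_elim
  case (elim n)
  let ?d = "CARD('n)"
  have "(v n * (hs n)\<^sup>2)\<^sup>2 \<le> 1" using elim by (intro power_le_one) auto
  then have "(v n)\<^sup>2 * hs n ^ 4 \<le> 1" by (simp add: power_mult_distrib flip: power_mult)
  then have "h n ^ ?d * ((v n)\<^sup>2 * hs n ^ 4) \<le> h n ^ ?d * 1"
    using elim by (intro mult_left_mono) auto
  moreover have "hs n ^ ?d \<le> (v n)\<^sup>2 * h n ^ ?d" using elim by (auto simp: le_divide_eq)
  then have "hs n ^ ?d * hs n ^ 4 \<le> (v n)\<^sup>2 * h n ^ ?d * hs n ^ 4"
    using elim by (intro mult_right_mono) auto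
  ultimately have "hs n ^ (?d + 4) \<le> h n ^ ?d" by (simp add: power_add mult_ac)
  \<comment> \<open>The base is at most 1 and d \<ge> 1, so the d-th power only decreases it; a d-th
    root can then be taken on both sides.\<close>
  moreover have "(hs n ^ (?d + 4)) ^ ?d \<le> (hs n ^ (?d + 4)) ^ 1"
    using elim by (intro power_decreasing power_le_one) (auto simp: Suc_leI)
  ultimately have "(hs n ^ (?d + 4)) ^ ?d \<le> h n ^ ?d" by simp
  then show ?case using elim power_mono_iff[of "hs n ^ (?d + 4)" "h n" ?d] by simp
qed

lemma scaled_bias_small: "0 < \<eta> \<Longrightarrow> \<forall>\<^sub>F n in sequentially. v n * (Z * hs n ^ 3 + Y * (hs n)\<^sup>2) \<le> \<eta>"
proof -
  assume "0 < \<eta>"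
  have "(\<lambda>n. Z * ((v n * (hs n)\<^sup>2) * hs n) + Y * (v n * (hs n)\<^sup>2)) \<longlonglongrightarrow> Z * (0 * 0) + Y * 0"
    by (intro tendsto_intros rate2 hs_lim)
  then have "\<forall>\<^sub>F n in sequentially. Z * ((v n * (hs n)\<^sup>2) * hs n) + Y * (v n * (hs n)\<^sup>2) < \<eta>"
    by (rule order_tendstoD) (use \<open>0 < \<eta>\<close> in simp)
  then show ?thesis
    by eventually_elim (simp add: eval_nat_numeral algebra_simps)
qed

lemma linear_bias_small: "0 < \<eta> \<Longrightarrow> \<forall>\<^sub>F n in sequentially. Z * h n + Y * hs n ^ 3 \<le> \<eta>"
proof -
  assume "0 < \<eta>"
  have "(\<lambda>n. Z * h n + Y * hs n ^ 3) \<longlonglongrightarrow> Z * 0 + Y * 0 ^ 3"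
    by (intro tendsto_intros h_lim hs_lim)
  then have "\<forall>\<^sub>F n in sequentially. Z * h n + Y * hs n ^ 3 < \<eta>"
    by (rule order_tendstoD) (use \<open>0 < \<eta>\<close> in simp)
  then show ?thesis by eventually_elim simp
qed

text \<open>The exponent n h_n^d is \<open>speed n\<close> times the quantity in
  \<open>rate3\<close>, which tends to infinity and so beats any prescribed Z.\<close>

lemma h_deviation:
  assumes "0 < \<eta>"
  shows "\<forall>\<^sub>F n in sequentially. \<forall>x. prob {\<omega> \<in> space M. \<eta> \<le> \<bar>est (h n) n \<omega> x - smoothed (h n) x\<bar>}
    \<le> 2 * exp (- (speed n * Z))"
proof -
  obtain \<gamma> where \<gamma>: "0 < \<gamma>" "\<And>h n x. 0 < h \<Longrightarrow> 1 \<le> n \<Longrightarrow>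
    prob {\<omega> \<in> space M. \<eta> \<le> \<bar>est h n \<omega> x - smoothed h x\<bar>} \<le> 2 * exp (- (\<gamma> * (real n * h ^ CARD('n))))"
    using est_fixed_deviation[OF assms] by blast
  have "\<forall>\<^sub>F n in sequentially. Z / \<gamma> \<le> (v n)\<^sup>2 * h n ^ CARD('n) / hs n ^ CARD('n)"
    using rate3 unfolding filterlim_at_top by blast
  then show ?thesis using basic_eventually
  proof eventually_elim
    case (elim n)
    have "0 \<le> speed n" using elim by (simp add: speed_def)
    then have "speed n * Z \<le> speed n * (\<gamma> * ((v n)\<^sup>2 * h n ^ CARD('n) / hs n ^ CARD('n)))"
      using elim \<gamma>(1) by (intro mult_left_mono) (simp_all add: pos_divide_le_eq mult.commute)
    also have "\<dots> = \<gamma> * (real n * h n ^ CARD('n))"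
      using elim by (simp add: speed_def)
    finally show ?case using \<gamma>(2)[of "h n" n] elim by (smt (verit) exp_le_cancel_iff)
  qed
qed

section \<open>The upper bound\<close>

text \<open>Chernoff's bound with l = s / v_n, so that n hs_n^d l^2 = speed n * s^2. The tilt
  depends on y, but f \<ge> c on C bounds it by S, which makes the error terms uniform over
  C.\<close>

lemma hs_deviation:
  assumes e: "0 < \<epsilon>"
  obtains \<epsilon>0 \<eta> where "0 < \<epsilon>0" "0 < \<eta>"
    "\<forall>\<^sub>F n in sequentially. \<forall>y\<in>C. prob {\<omega> \<in> space M.
       (\<delta> * sqrt ((f y - 2 * \<epsilon>0) * \<kappa>) - \<eta>) / v n \<le> \<bar>est (hs n) n \<omega> y - smoothed (hs n) y\<bar>}
     \<le> 2 * exp (- (speed n * (\<delta>\<^sup>2 / 2 - \<epsilon>)))"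
proof -
  define S where "S = \<delta> / sqrt (c * \<kappa>)"
  have S: "0 < S" using \<delta>_pos c_pos kappa_pos by (simp add: S_def)
  \<comment> \<open>With 2 \<epsilon>0 \<le> c the radicand stays nonnegative on C. Lowering f by 2
    \<epsilon>0, lowering the threshold by \<eta>, and the excess of the variance term cost
    \<epsilon> / 4 each.\<close>
  define \<epsilon>0 where "\<epsilon>0 = min (c / 2) (\<epsilon> * c / (8 * \<delta>\<^sup>2))"
  define \<eta> where "\<eta> = \<epsilon> / (4 * S)"
  have e0: "0 < \<epsilon>0" "2 * \<epsilon>0 \<le> c" "\<delta>\<^sup>2 * (2 * \<epsilon>0 / c) \<le> \<epsilon> / 4"
  proof -
    show "0 < \<epsilon>0" "2 * \<epsilon>0 \<le> c" using e c_pos \<delta>_pos by (auto simp: \<epsilon>0_def)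
    have "\<epsilon>0 \<le> \<epsilon> * c / (8 * \<delta>\<^sup>2)" by (simp add: \<epsilon>0_def)
    then show "\<delta>\<^sup>2 * (2 * \<epsilon>0 / c) \<le> \<epsilon> / 4" using c_pos \<delta>_pos by (simp add: field_simps)
  qed
  have eta: "0 < \<eta>" "\<eta> * S = \<epsilon> / 4" using e S by (auto simp: \<eta>_def)
  have "(\<lambda>n. S\<^sup>2 / 2 * (B * G * m1 * hs n) + S\<^sup>2 / 2 * (S * B / v n) * (F * \<kappa>))
      \<longlonglongrightarrow> S\<^sup>2 / 2 * (B * G * m1 * 0) + S\<^sup>2 / 2 * 0 * (F * \<kappa>)"
    by (intro tendsto_intros hs_lim tendsto_divide_0[OF tendsto_const] filterlim_at_top_imp_at_infinity v_lim)
  then have "\<forall>\<^sub>F n in sequentially. S\<^sup>2 / 2 * (B * G * m1 * hs n) + S\<^sup>2 / 2 * (S * B / v n) * (F * \<kappa>) < \<epsilon> / 4"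
    by (rule order_tendstoD) (use e in simp)
  moreover have "\<forall>\<^sub>F n in sequentially. S * B \<le> v n"
    using v_lim unfolding filterlim_at_top by blast
  ultimately have "\<forall>\<^sub>F n in sequentially. \<forall>y\<in>C. prob {\<omega> \<in> space M.
       (\<delta> * sqrt ((f y - 2 * \<epsilon>0) * \<kappa>) - \<eta>) / v n \<le> \<bar>est (hs n) n \<omega> y - smoothed (hs n) y\<bar>}
     \<le> 2 * exp (- (speed n * (\<delta>\<^sup>2 / 2 - \<epsilon>)))"
    using basic_eventually
  proof eventually_elim
    case (elim n)
    show ?case
    proof
      fix y assume y: "y \<in> C"
      define u where "u = f y"
      have u: "c \<le> u" "0 < u" using f_ge[OF y] c_pos by (auto simp: u_def)
      \<comment> \<open>the minimiser of the limiting exponent \<open>s\<^sup>2 f(y) \<kappa> / 2 - s \<delta> sqrt (f(y) \<kappa>)\<close>\<close>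
      define s where "s = \<delta> / sqrt (u * \<kappa>)"
      define t where "t = \<delta> * sqrt ((u - 2 * \<epsilon>0) * \<kappa>) - \<eta>"
      define r where "r = hs n"
      define V where "V = v n"
      define q where "q = smoothed_sq r y"
      have pos: "0 < V" "0 < r" "1 \<le> n" using elim by (auto simp: V_def r_def)
      have s0: "0 < s" using \<delta>_pos u kappa_pos by (simp add: s_def)
      have sS: "s \<le> S" unfolding s_def S_def using \<delta>_pos u c_pos kappa_pos
        by (intro divide_left_mono real_sqrt_le_mono mult_right_mono mult_pos_pos) auto
      have s2: "s\<^sup>2 * (u * \<kappa>) = \<delta>\<^sup>2"
        using u kappa_pos by (simp add: s_def power_divide)
      have st: "\<delta>\<^sup>2 - \<epsilon> / 2 \<le> s * t"
      proof -
        define w where "w = (u - 2 * \<epsilon>0) / u"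
        have w: "0 \<le> w" "w \<le> 1" using u e0 by (auto simp: w_def)
        \<comment> \<open>On the unit interval this replaces the square root by a linear lower
          bound, so the loss is at most the relative error 2 \<epsilon>0 / c.\<close>
        have "w \<le> sqrt w" using w by (simp add: real_le_rsqrt power2_eq_square mult_left_le)
        have "2 * \<epsilon>0 / u \<le> 2 * \<epsilon>0 / c" using e0 u c_pos by (intro divide_left_mono) auto
        then have "1 - 2 * \<epsilon>0 / c \<le> w" using u by (simp add: w_def diff_divide_distrib)
        then have "1 - 2 * \<epsilon>0 / c \<le> sqrt w" using \<open>w \<le> sqrt w\<close> by linarith
        then have "\<delta>\<^sup>2 * (1 - 2 * \<epsilon>0 / c) \<le> \<delta>\<^sup>2 * sqrt w" by (intro mult_left_mono) auto
        also have "\<dots> = s * (\<delta> * sqrt ((u - 2 * \<epsilon>0) * \<kappa>))"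
          using kappa_pos u by (simp add: s_def w_def real_sqrt_divide real_sqrt_mult power2_eq_square)
        finally have "\<delta>\<^sup>2 - \<epsilon> / 4 \<le> s * (\<delta> * sqrt ((u - 2 * \<epsilon>0) * \<kappa>))"
          using e0(3) by (simp add: right_diff_distrib)
        moreover have "s * \<eta> \<le> \<epsilon> / 4"
          using mult_right_mono[OF sS less_imp_le[OF eta(1)]] eta(2) by (simp add: mult.commute[of S \<eta>])
        ultimately show ?thesis unfolding t_def right_diff_distrib by linarith
      qed
      have q: "0 \<le> q" "q \<le> F * \<kappa>" "q \<le> u * \<kappa> + B * G * m1 * r"
        using smoothed_sq_nonneg[of r y] smoothed_sq_le[of r y] smoothed_sq_bias[of r y] pos
        by (auto simp: q_def u_def)
      have var: "s\<^sup>2 / 2 * (1 + s * B / V) * q \<le> \<delta>\<^sup>2 / 2 + \<epsilon> / 4"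
      proof -
        have s2S: "s\<^sup>2 \<le> S\<^sup>2" using sS s0 by (intro power_mono) auto
        have "s\<^sup>2 / 2 * (1 + s * B / V) * q = s\<^sup>2 / 2 * q + s\<^sup>2 / 2 * (s * B / V) * q"
          by (simp add: algebra_simps)
        also have "s\<^sup>2 / 2 * q \<le> s\<^sup>2 / 2 * (u * \<kappa> + B * G * m1 * r)"
          using q by (intro mult_left_mono) auto
        also have "\<dots> = \<delta>\<^sup>2 / 2 + s\<^sup>2 / 2 * (B * G * m1 * r)"
          using s2 by (simp add: distrib_left)
        also have "s\<^sup>2 / 2 * (B * G * m1 * r) \<le> S\<^sup>2 / 2 * (B * G * m1 * r)"
          using s2S B_pos consts_nonneg m1_nonneg pos by (intro mult_right_mono mult_nonneg_nonneg) auto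
        also have "s\<^sup>2 / 2 * (s * B / V) * q \<le> S\<^sup>2 / 2 * (S * B / V) * (F * \<kappa>)"
          using s2S sS s0 S B_pos pos q
          by (intro mult_mono divide_right_mono mult_nonneg_nonneg) auto
        finally show ?thesis using elim(1) unfolding r_def V_def by linarith
      qed
      have lB: "s / V * B \<le> 1"
        using elim(2) mult_right_mono[OF sS less_imp_le[OF B_pos]] pos by (simp add: V_def)
      have "prob {\<omega> \<in> space M. t / V \<le> \<bar>est r n \<omega> y - smoothed r y\<bar>}
        \<le> 2 * exp (- (real n * r ^ CARD('n) * (s / V * (t / V) - (s / V)\<^sup>2 / 2 * (1 + s / V * B) * q)))"
        unfolding q_def using pos s0 lB by (intro est_deviation) auto
      also have "real n * r ^ CARD('n) * (s / V * (t / V) - (s / V)\<^sup>2 / 2 * (1 + s / V * B) * q)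
        = speed n * (s * t - s\<^sup>2 / 2 * (1 + s * B / V) * q)"
        using pos by (simp add: speed_def r_def[symmetric] V_def[symmetric] power2_eq_square field_simps)
      also have "2 * exp (- (speed n * (s * t - s\<^sup>2 / 2 * (1 + s * B / V) * q))) \<le> 2 * exp (- (speed n * (\<delta>\<^sup>2 / 2 - \<epsilon>)))"
      proof -
        have "0 \<le> speed n" using pos by (simp add: speed_def r_def)
        then have "speed n * (\<delta>\<^sup>2 / 2 - \<epsilon>) \<le> speed n * (s * t - s\<^sup>2 / 2 * (1 + s * B / V) * q)"
          by (intro mult_left_mono) (use st var e in linarith)+
        then show ?thesis by simp
      qed
      finally show "prob {\<omega> \<in> space M.
         (\<delta> * sqrt ((f y - 2 * \<epsilon>0) * \<kappa>) - \<eta>) / v n \<le> \<bar>est (hs n) n \<omega> y - smoothed (hs n) y\<bar>}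
       \<le> 2 * exp (- (speed n * (\<delta>\<^sup>2 / 2 - \<epsilon>)))"
        unfolding t_def u_def r_def V_def .
    qed
  qed
  with e0(1) eta(1) that show ?thesis by blast
qed

lemma miss_prob_le:
  assumes e: "0 < \<epsilon>"
  shows "\<forall>\<^sub>F n in sequentially. miss_prob n \<le> exp (- (speed n * (\<delta>\<^sup>2 / 2 - \<epsilon>)))"
proof -
  obtain \<epsilon>0 \<eta> where e0: "0 < \<epsilon>0" and eta: "0 < \<eta>" and dev:
    "\<forall>\<^sub>F n in sequentially. \<forall>y\<in>C. prob {\<omega> \<in> space M.
       (\<delta> * sqrt ((f y - 2 * \<epsilon>0) * \<kappa>) - \<eta>) / v n \<le> \<bar>est (hs n) n \<omega> y - smoothed (hs n) y\<bar>}
     \<le> 2 * exp (- (speed n * (\<delta>\<^sup>2 / 2 - \<epsilon> / 2)))"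
    by (rule hs_deviation[OF half_gt_zero[OF e]])
  obtain p :: nat where p: "3 \<le> p" and osc: "\<And>r b x y n \<omega>. 0 < r \<Longrightarrow> r < 1 \<Longrightarrow> r ^ (CARD('n) + 4) \<le> b \<Longrightarrow>
    norm (x - y) \<le> r ^ p \<Longrightarrow> \<bar>est b n \<omega> x - est b n \<omega> y\<bar> \<le> L * r ^ 3"
    using est_Hoelder_net by blast
  obtain N where N: "1 \<le> N" and net: "\<And>\<rho>. 0 < \<rho> \<Longrightarrow> \<rho> \<le> 1 \<Longrightarrow>
    \<exists>T\<subseteq>C. finite T \<and> real (card T) \<le> N * (1 / \<rho>) ^ CARD('n) \<and> (\<forall>x\<in>C. \<exists>y\<in>T. norm (x - y) \<le> \<rho>)"
    using finite_net_exists[OF C_bounded] by blast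
  \<comment> \<open>The net has at most N r^(- p d) points, each contributing 4 \<open>Ex\<close>.
    The power of r and the constant 4 N are each absorbed by exp (A \<epsilon> / 4), the other half
    of the allowance \<epsilon> being spent in \<open>dev\<close>.\<close>
  have *: "\<forall>\<^sub>F n in sequentially. 8 * real (p * CARD('n)) / (2 * \<epsilon>) * ln (1 / hs n) \<le> speed n"
    by (rule speed_ge_ln)
  have **: "\<forall>\<^sub>F n in sequentially. 8 * ln (4 * N) / (2 * \<epsilon>) \<le> speed n"
    by (rule speed_ge)
  note ev = basic_eventually h_ge dev h_deviation[OF e0, of "\<delta>\<^sup>2 / 2 - \<epsilon> / 2"]
    scaled_bias_small[OF eta, of "L + G" "H * m2"] linear_bias_small[OF e0, of "G * m1" L] * **
  from ev show ?thesis
  proof eventually_elim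
    case (elim n)
    define r where "r = hs n"
    define A where "A = speed n"
    define Ex where "Ex = exp (- (A * (\<delta>\<^sup>2 / 2 - \<epsilon> / 2)))"
    have r: "0 < r" "r < 1" using elim(1) by (auto simp: r_def)
    obtain T where T: "T \<subseteq> C" "finite T" "real (card T) \<le> N * (1 / r ^ p) ^ CARD('n)"
      "\<And>x. x \<in> C \<Longrightarrow> \<exists>y\<in>T. norm (x - y) \<le> r ^ p"
      using net[of "r ^ p"] r power_le_one[of r p] by auto
    let ?P = "\<lambda>y. {\<omega> \<in> space M. \<epsilon>0 \<le> \<bar>est (h n) n \<omega> y - smoothed (h n) y\<bar>}"
    let ?Q = "\<lambda>y. {\<omega> \<in> space M. (\<delta> * sqrt ((f y - 2 * \<epsilon>0) * \<kappa>) - \<eta>) / v n \<le> \<bar>est r n \<omega> y - smoothed r y\<bar>}"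
    have "miss r (h n) (v n) \<delta> C n \<subseteq> (\<Union>y\<in>T. ?P y \<union> ?Q y)"
    proof (rule miss_subset_net[where \<rho>="r ^ p" and e="L * r ^ 3"])
      show "\<bar>est r n \<omega> x - est r n \<omega> y\<bar> \<le> L * r ^ 3" if "norm (x - y) \<le> r ^ p" for n \<omega> x y
      proof (rule osc[OF r _ that])
        show "r ^ (CARD('n) + 4) \<le> r" using r power_decreasing[of 1 "CARD('n) + 4" r] by simp
      qed
      show "\<bar>est (h n) m \<omega> x - est (h n) m \<omega> y\<bar> \<le> L * r ^ 3" if "norm (x - y) \<le> r ^ p" for m \<omega> x y
        by (rule osc[OF r _ that]) (use elim(2) in \<open>simp add: r_def\<close>)
      show "G * m1 * h n + L * r ^ 3 \<le> \<epsilon>0" using elim(6) by (simp add: r_def)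
      have "G * r ^ p \<le> G * r ^ 3" using r p consts_nonneg by (intro mult_left_mono power_decreasing) auto
      then have "v n * (L * r ^ 3 + G * r ^ p + H * m2 * r\<^sup>2) \<le> v n * ((L + G) * r ^ 3 + H * m2 * r\<^sup>2)"
        using elim(1) by (intro mult_left_mono) (auto simp: distrib_right)
      then show "v n * (L * r ^ 3 + G * r ^ p + H * m2 * r\<^sup>2) \<le> \<eta>" using elim(5) by (simp add: r_def)
    qed (use elim(1) \<delta>_pos T r in \<open>auto simp: r_def\<close>)
    then have "prob (miss r (h n) (v n) \<delta> C n) \<le> prob (\<Union>y\<in>T. ?P y \<union> ?Q y)"
      using T(2) by (intro finite_measure_mono sets.finite_UN) auto
    also have "\<dots> \<le> (\<Sum>y\<in>T. prob (?P y \<union> ?Q y))"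
      using T(2) by (intro finite_measure_subadditive_finite) auto
    also have "\<dots> \<le> (\<Sum>y\<in>T. 4 * Ex)"
    proof (rule sum_mono)
      fix y assume "y \<in> T"
      then have "prob (?P y) \<le> 2 * Ex" "prob (?Q y) \<le> 2 * Ex"
        using elim(3,4) T(1) by (auto simp: Ex_def A_def r_def)
      then show "prob (?P y \<union> ?Q y) \<le> 4 * Ex"
        using measure_Un_le[of "?P y" M "?Q y"] by simp
    qed
    also have "\<dots> = 4 * real (card T) * Ex" by simp
    also have "\<dots> \<le> 4 * (N * (1 / r ^ p) ^ CARD('n)) * Ex"
      using T(3) by (intro mult_right_mono mult_left_mono) (auto simp: Ex_def)
    also have "4 * (N * (1 / r ^ p) ^ CARD('n)) \<le> exp (A * \<epsilon> / 2)"
    proof -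
      have "(1 / r ^ p) ^ CARD('n) = (1 / r) ^ (p * CARD('n))"
        by (simp add: power_one_over power_mult)
      also have "\<dots> = exp (real (p * CARD('n)) * ln (1 / r))"
        unfolding exp_of_nat_mult using r by simp
      also have "\<dots> \<le> exp (A * \<epsilon> / 4)"
        using elim(7) e by (simp add: r_def A_def field_simps)
      finally have 1: "(1 / r ^ p) ^ CARD('n) \<le> exp (A * \<epsilon> / 4)" .
      have "ln (4 * N) \<le> A * \<epsilon> / 4" using elim(8) e by (simp add: A_def field_simps)
      then have "exp (ln (4 * N)) \<le> exp (A * \<epsilon> / 4)" by simp
      then have 2: "4 * N \<le> exp (A * \<epsilon> / 4)" using N by simp
      have "4 * N * (1 / r ^ p) ^ CARD('n) \<le> exp (A * \<epsilon> / 4) * exp (A * \<epsilon> / 4)"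
        using 1 2 r by (intro mult_mono) auto
      also have "\<dots> = exp (A * \<epsilon> / 2)" by (simp flip: exp_add)
      finally show ?thesis by (simp add: mult.assoc)
    qed
    also have "exp (A * \<epsilon> / 2) * Ex = exp (- (A * (\<delta>\<^sup>2 / 2 - \<epsilon>)))"
      unfolding Ex_def by (simp add: exp_add[symmetric] algebra_simps)
    finally show ?case by (simp add: r_def A_def Ex_def mult_right_mono)
  qed
qed

section \<open>The lower bound and the limit\<close>

lemma smoothed_sq_lim: "(\<lambda>n. smoothed_sq (hs n) x) \<longlonglongrightarrow> f x * \<kappa>"
proof (rule LIM_zero_cancel)
  have lim: "(\<lambda>n. B * G * m1 * hs n) \<longlonglongrightarrow> 0"
    using tendsto_mult_left[OF hs_lim, of "B * G * m1"] by simp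
  show "(\<lambda>n. smoothed_sq (hs n) x - f x * \<kappa>) \<longlonglongrightarrow> 0"
    by (rule Lim_null_comparison[OF _ lim], rule eventually_mono[OF basic_eventually])
      (use smoothed_sq_bias in auto)
qed

lemma smoothed_lim: "(\<lambda>n. smoothed (hs n) x) \<longlonglongrightarrow> f x"
proof (rule LIM_zero_cancel)
  have lim: "(\<lambda>n. G * m1 * hs n) \<longlonglongrightarrow> 0"
    using tendsto_mult_left[OF hs_lim, of "G * m1"] by simp
  show "(\<lambda>n. smoothed (hs n) x - f x) \<longlonglongrightarrow> 0"
    by (rule Lim_null_comparison[OF _ lim], rule eventually_mono[OF basic_eventually])
      (use smoothed_bias1 in auto)
qed

text \<open>The general lower bound asks for integrability at every index, whereas the bandwidth and
  v are positive only from n = 1 on; the value 0 at n = 0 makes that case immediate.\<close>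

definition scaled_error :: "real ^ 'n \<Rightarrow> nat \<Rightarrow> 'w \<Rightarrow> real"
  where "scaled_error x n \<omega> = (if n = 0 then 0 else v n * (est (hs n) n \<omega> x - smoothed (hs n) x))"

lemma scaled_error_measurable[measurable]: "random_variable borel (scaled_error x n)"
  unfolding scaled_error_def by measurable

lemma scaled_error_exponent:
  assumes "1 \<le> n"
  shows "s * speed n * scaled_error x n \<omega>
    = s / v n * (real n * hs n ^ CARD('n) * (est (hs n) n \<omega> x - smoothed (hs n) x))"
  using v_pos[OF assms] assms by (simp add: scaled_error_def speed_def power2_eq_square)

lemma scaled_error_exp_integrable: "integrable M (\<lambda>\<omega>. exp (s * speed n * scaled_error x n \<omega>))"
proof (cases "n = 0")
  case True
  then show ?thesis by (simp add: scaled_error_def)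
next
  case False
  then have n: "1 \<le> n" by simp
  show ?thesis
    unfolding scaled_error_exponent[OF n] by (rule est_mgf(1)[OF hs_pos[OF n] n])
qed

text \<open>The moment lies between (1 + w)^n and exp (speed n * up n), where n w = speed n * u n.
  As w tends to 0, taking the logarithm of the lower bound costs only the factor 1 - w, and both
  sides have the same limit.\<close>

lemma scaled_error_mgf_lim:
  assumes fx: "0 < f x" and s: "0 < s"
  shows "(\<lambda>n. ln (expectation (\<lambda>\<omega>. exp (s * speed n * scaled_error x n \<omega>))) / speed n)
    \<longlonglongrightarrow> s\<^sup>2 * (f x * \<kappa>) / 2"
proof -
  define q where "q n = smoothed_sq (hs n) x" for n
  define g where "g n = q n - hs n ^ CARD('n) * (smoothed (hs n) x)\<^sup>2" for n
  define up where "up n = s\<^sup>2 / 2 * (1 + s / v n * B) * q n" for n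
  define u where "u n = s\<^sup>2 / 2 * (1 - s / v n * B) * g n" for n
  define w where "w n = hs n ^ CARD('n) * (1 / v n)\<^sup>2 * u n" for n
  have V: "0 < f x * \<kappa>" using fx kappa_pos by simp
  have vlim: "(\<lambda>n. c / v n) \<longlonglongrightarrow> 0" for c :: real
    by (intro tendsto_divide_0[OF tendsto_const] filterlim_at_top_imp_at_infinity v_lim)
  \<comment> \<open>The dimension is positive, so hs_n^d tends to 0 and both the squared mean and w
    vanish in the limit.\<close>
  have zero: "(0::real) ^ CARD('n) = 0" by (simp add: zero_power)
  have q: "q \<longlonglongrightarrow> f x * \<kappa>" unfolding q_def[abs_def] by (rule smoothed_sq_lim)
  have "g \<longlonglongrightarrow> f x * \<kappa> - 0 ^ CARD('n) * (f x)\<^sup>2"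
    unfolding g_def[abs_def] by (intro tendsto_intros q hs_lim smoothed_lim)
  then have g: "g \<longlonglongrightarrow> f x * \<kappa>" unfolding zero by (simp only: mult_zero_left diff_zero)
  have "up \<longlonglongrightarrow> s\<^sup>2 / 2 * (1 + 0 * B) * (f x * \<kappa>)"
    unfolding up_def[abs_def] by (intro tendsto_intros vlim q)
  then have up: "up \<longlonglongrightarrow> s\<^sup>2 * (f x * \<kappa>) / 2" by simp
  have "u \<longlonglongrightarrow> s\<^sup>2 / 2 * (1 - 0 * B) * (f x * \<kappa>)"
    unfolding u_def[abs_def] by (intro tendsto_intros vlim g)
  then have u: "u \<longlonglongrightarrow> s\<^sup>2 * (f x * \<kappa>) / 2" by simp
  have "w \<longlonglongrightarrow> 0 ^ CARD('n) * 0\<^sup>2 * (s\<^sup>2 * (f x * \<kappa>) / 2)"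
    unfolding w_def[abs_def] by (intro tendsto_intros vlim u hs_lim)
  then have w: "w \<longlonglongrightarrow> 0" unfolding zero by (simp only: mult_zero_left)
  have "(\<lambda>n. u n * (1 - w n)) \<longlonglongrightarrow> s\<^sup>2 * (f x * \<kappa>) / 2 * (1 - 0)"
    by (intro tendsto_intros u w)
  then have low: "(\<lambda>n. u n * (1 - w n)) \<longlonglongrightarrow> s\<^sup>2 * (f x * \<kappa>) / 2" by simp
  have "\<forall>\<^sub>F n in sequentially. s * B \<le> v n"
    using v_lim unfolding filterlim_at_top by blast
  moreover have "\<forall>\<^sub>F n in sequentially. 0 < g n"
    by (rule order_tendstoD[OF g]) (use V in simp)
  moreover have "\<forall>\<^sub>F n in sequentially. 0 < u n"
    by (rule order_tendstoD[OF u]) (use V s in simp)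
  moreover have "\<forall>\<^sub>F n in sequentially. w n < 1"
    by (rule order_tendstoD[OF w]) simp
  moreover have "\<forall>\<^sub>F n in sequentially. 1 \<le> speed n" by (rule speed_ge)
  ultimately have "\<forall>\<^sub>F n in sequentially.
     u n * (1 - w n) \<le> ln (expectation (\<lambda>\<omega>. exp (s * speed n * scaled_error x n \<omega>))) / speed n
     \<and> ln (expectation (\<lambda>\<omega>. exp (s * speed n * scaled_error x n \<omega>))) / speed n \<le> up n"
    using basic_eventually
  proof eventually_elim
    case (elim n)
    then have n: "1 \<le> n" and v0: "0 < v n" and r: "0 < hs n" by auto
    define r where "r = hs n"
    define E where "E = expectation (\<lambda>\<omega>. exp (s * speed n * scaled_error x n \<omega>))"
    have l: "\<bar>s / v n\<bar> * B \<le> 1" using elim(1) s v0 by simp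
    have w0: "0 \<le> w n" using elim(3) r by (simp add: w_def)
    have "(1 + r ^ CARD('n) * ((s / v n)\<^sup>2 / 2 * (1 - \<bar>s / v n\<bar> * B) * g n)) ^ n \<le> E"
      unfolding E_def scaled_error_exponent[OF n] g_def q_def r_def
      using elim(2) by (intro est_mgf_ge hs_pos n l) (simp add: g_def q_def)
    also have "r ^ CARD('n) * ((s / v n)\<^sup>2 / 2 * (1 - \<bar>s / v n\<bar> * B) * g n) = w n"
      using s v0 by (simp add: w_def u_def r_def power_divide)
    finally have E1: "(1 + w n) ^ n \<le> E" .
    have "E \<le> exp (real n * r ^ CARD('n) * ((s / v n)\<^sup>2 / 2 * (1 + \<bar>s / v n\<bar> * B) * q n))"
      unfolding E_def scaled_error_exponent[OF n] q_def r_def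
      by (intro est_mgf_le hs_pos n l)
    also have "real n * r ^ CARD('n) * ((s / v n)\<^sup>2 / 2 * (1 + \<bar>s / v n\<bar> * B) * q n) = speed n * up n"
      using s v0 by (simp add: speed_def up_def r_def power_divide)
    finally have E2: "E \<le> exp (speed n * up n)" .
    have "0 < (1 + w n) ^ n" using w0 by simp
    then have E0: "0 < E" using E1 by linarith
    have "ln E \<le> speed n * up n"
      using E2 E0 by (metis ln_exp ln_le_cancel_iff exp_gt_zero)
    then have U: "ln E / speed n \<le> up n" using elim(5) by (simp add: divide_le_eq mult.commute)
    \<comment> \<open>The estimate ln (1 + w) \<ge> w - w^2 holds for w between 0 and 1.\<close>
    have "real n * (w n - (w n)\<^sup>2) \<le> real n * ln (1 + w n)"
      using w0 elim(4) by (intro mult_left_mono ln_one_plus_pos_lower_bound) auto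
    also have "\<dots> = ln ((1 + w n) ^ n)" using w0 by (simp add: ln_realpow)
    also have "\<dots> \<le> ln E" using E1 E0 w0 by simp
    also have "real n * (w n - (w n)\<^sup>2) = speed n * (u n * (1 - w n))"
    proof -
      have "real n * w n = speed n * u n" using v0 by (simp add: w_def speed_def power_divide)
      moreover have "real n * (w n - (w n)\<^sup>2) = real n * w n * (1 - w n)"
        by (simp add: power2_eq_square algebra_simps)
      ultimately show ?thesis by simp
    qed
    finally have "u n * (1 - w n) \<le> ln E / speed n" using elim(5) by (simp add: le_divide_eq mult.commute)
    with U show ?case unfolding E_def by blast
  qed
  then show ?thesis
    by (intro tendsto_sandwich[OF _ _ low up]) (auto elim: eventually_mono)
qed

text \<open>At a single x, a scaled error above t forces a miss unless the width estimator deviates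
  by \<eta>. Inside t, the summand 2 \<eta> allows for the deviation and bias of that estimator, and
  the outer \<eta> for the magnified bias of the centre. The allowance \<epsilon> is split in three:
  the passage to t, the general lower bound, and a factor 1/2.\<close>

lemma miss_prob_ge:
  assumes e: "0 < \<epsilon>"
  shows "\<forall>\<^sub>F n in sequentially. exp (- (speed n * (\<delta>\<^sup>2 / 2 + \<epsilon>))) \<le> miss_prob n"
proof -
  obtain x where x: "x \<in> C" using C_nonempty by blast
  then have fx: "0 < f x" using f_ge[OF x] c_pos by simp
  define V where "V = f x * \<kappa>"
  have V: "0 < V" using fx kappa_pos by (simp add: V_def)
  have "((\<lambda>\<eta>. (\<delta> * sqrt ((f x + 2 * \<eta>) * \<kappa>) + \<eta>)\<^sup>2 / (2 * V)) \<longlongrightarrow> (\<delta> * sqrt ((f x + 2 * 0) * \<kappa>) + 0)\<^sup>2 / (2 * V)) (at_right 0)"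
    by (intro tendsto_intros) (use V in auto)
  moreover have "(\<delta> * sqrt ((f x + 2 * 0) * \<kappa>) + 0)\<^sup>2 / (2 * V) = \<delta>\<^sup>2 / 2"
    using V by (simp add: V_def[symmetric] power_mult_distrib)
  ultimately have "((\<lambda>\<eta>. (\<delta> * sqrt ((f x + 2 * \<eta>) * \<kappa>) + \<eta>)\<^sup>2 / (2 * V)) \<longlongrightarrow> \<delta>\<^sup>2 / 2) (at_right 0)"
    by (simp only:)
  then have "\<forall>\<^sub>F \<eta> in at_right 0. (\<delta> * sqrt ((f x + 2 * \<eta>) * \<kappa>) + \<eta>)\<^sup>2 / (2 * V) < \<delta>\<^sup>2 / 2 + \<epsilon> / 3"
    by (rule order_tendstoD) (use e in auto)
  then have "\<forall>\<^sub>F \<eta> in at_right 0. (\<delta> * sqrt ((f x + 2 * \<eta>) * \<kappa>) + \<eta>)\<^sup>2 / (2 * V) < \<delta>\<^sup>2 / 2 + \<epsilon> / 3 \<and> 0 < \<eta>"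
    by (intro eventually_conj) (auto simp: eventually_at_right_less)
  then obtain \<eta> where eta: "0 < \<eta>" "(\<delta> * sqrt ((f x + 2 * \<eta>) * \<kappa>) + \<eta>)\<^sup>2 / (2 * V) < \<delta>\<^sup>2 / 2 + \<epsilon> / 3"
    using eventually_happens'[OF trivial_limit_at_right_real] by blast
  define t where "t = \<delta> * sqrt ((f x + 2 * \<eta>) * \<kappa>) + \<eta>"
  have t: "0 < t" using eta \<delta>_pos fx kappa_pos by (simp add: t_def add_nonneg_pos)
  define W where "W = \<delta>\<^sup>2 / 2 + 2 * \<epsilon> / 3"
  have main: "\<forall>\<^sub>F n in sequentially. exp (- speed n * (t\<^sup>2 / (2 * V) + \<epsilon> / 3))
     \<le> prob {\<omega> \<in> space M. t < scaled_error x n \<omega>}"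
    by (rule exponential_lower_bound) (use t V e scaled_error_exp_integrable speed_at_top
        scaled_error_mgf_lim[OF fx] in \<open>auto simp: V_def\<close>)
  show ?thesis
    \<comment> \<open>One unit more than W makes the excluded event at most half of exp (- A W) as
      soon as A \<ge> ln 4.\<close>
    using main basic_eventually h_deviation[OF eta(1), of "W + 1"]
      scaled_bias_small[OF eta(1), of 0 "H * m2"] linear_bias_small[OF eta(1), of "G * m1" 0]
      speed_ge[of "ln 4"] speed_ge[of "3 * ln 2 / \<epsilon>"]
  proof eventually_elim
    case (elim n)
    then have n: "1 \<le> n" and v0: "0 < v n" and r: "0 < hs n" and h0: "0 < h n" by auto
    define A where "A = speed n"
    let ?P = "{\<omega> \<in> space M. \<eta> \<le> \<bar>est (h n) n \<omega> x - smoothed (h n) x\<bar>}"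
    have sub: "{\<omega> \<in> space M. t < scaled_error x n \<omega>} \<subseteq> miss (hs n) (h n) (v n) \<delta> C n \<union> ?P"
    proof
      fix \<omega> assume w: "\<omega> \<in> {\<omega> \<in> space M. t < scaled_error x n \<omega>}"
      show "\<omega> \<in> miss (hs n) (h n) (v n) \<delta> C n \<union> ?P"
      proof (rule ccontr)
        assume no: "\<omega> \<notin> miss (hs n) (h n) (v n) \<delta> C n \<union> ?P"
        have "\<bar>est (h n) n \<omega> x - smoothed (h n) x\<bar> < \<eta>" using no w by auto
        then have "est (h n) n \<omega> x \<le> f x + 2 * \<eta>"
          using smoothed_bias1[of "h n" x] h0 elim(5) by simp
        then have "sqrt (est (h n) n \<omega> x * \<kappa>) \<le> sqrt ((f x + 2 * \<eta>) * \<kappa>)"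
          using kappa_pos by (intro real_sqrt_le_mono mult_right_mono) auto
        then have 1: "\<delta> * sqrt (est (h n) n \<omega> x * \<kappa>) \<le> t - \<eta>"
          unfolding t_def using \<delta>_pos by simp
        have "v n * \<bar>f x - est (hs n) n \<omega> x\<bar> \<le> \<delta> * sqrt (est (h n) n \<omega> x * \<kappa>)"
          using no w x v0 by (force simp: miss_def not_less field_simps)
        moreover have "t < v n * (est (hs n) n \<omega> x - smoothed (hs n) x)"
          using w n by (simp add: scaled_error_def)
        moreover have "v n * \<bar>smoothed (hs n) x - f x\<bar> \<le> \<eta>"
          using mult_left_mono[OF smoothed_bias2[OF less_imp_le[OF r], of x] less_imp_le[OF v0]] elim(4) by simp
        moreover have "v n * (est (hs n) n \<omega> x - smoothed (hs n) x)
           \<le> v n * \<bar>f x - est (hs n) n \<omega> x\<bar> + v n * \<bar>smoothed (hs n) x - f x\<bar>"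
          using v0 unfolding distrib_left[symmetric] by (intro mult_left_mono) auto
        ultimately show False using 1 by linarith
      qed
    qed
    have "prob {\<omega> \<in> space M. t < scaled_error x n \<omega>} \<le> prob (miss (hs n) (h n) (v n) \<delta> C n \<union> ?P)"
      by (intro finite_measure_mono sub) auto
    also have "\<dots> \<le> miss_prob n + prob ?P" by (intro measure_Un_le) auto
    finally have 1: "exp (- A * (t\<^sup>2 / (2 * V) + \<epsilon> / 3)) \<le> miss_prob n + 2 * exp (- (A * (W + 1)))"
      using elim(1) spec[OF elim(3), of x] unfolding A_def by linarith
    have A: "ln 4 \<le> A" "ln 2 \<le> A * \<epsilon> / 3" "0 \<le> A"
      using elim(6,7) e n r v0 by (auto simp: A_def field_simps speed_def)
    have "A * (t\<^sup>2 / (2 * V) + \<epsilon> / 3) \<le> A * W"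
      using eta(2) A by (intro mult_left_mono) (auto simp: W_def t_def)
    then have 2: "exp (- (A * W)) \<le> exp (- A * (t\<^sup>2 / (2 * V) + \<epsilon> / 3))" by simp
    have "exp (- A) \<le> exp (- ln 4)" using A by simp
    then have "exp (- A) \<le> 1 / 4" by (simp add: exp_minus)
    then have "exp (- (A * W)) * exp (- A) \<le> exp (- (A * W)) * (1 / 4)" by (intro mult_left_mono) auto
    then have 3: "2 * exp (- (A * (W + 1))) \<le> exp (- (A * W)) / 2"
      by (simp add: exp_add[symmetric] algebra_simps)
    have "exp (- (A * \<epsilon> / 3)) \<le> exp (- ln 2)" using A by simp
    then have "exp (- (A * \<epsilon> / 3)) \<le> 1 / 2" by (simp add: exp_minus)
    then have "exp (- (A * W)) * exp (- (A * \<epsilon> / 3)) \<le> exp (- (A * W)) * (1 / 2)" by (intro mult_left_mono) auto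
    moreover have "exp (- (A * W)) * exp (- (A * \<epsilon> / 3)) = exp (- (A * (\<delta>\<^sup>2 / 2 + \<epsilon>)))"
      by (simp add: W_def exp_add[symmetric] algebra_simps)
    ultimately show ?case using 1 2 3 unfolding A_def by linarith
  qed
qed

lemma ln_miss_prob_lim: "(\<lambda>n. ln (miss_prob n) / speed n) \<longlonglongrightarrow> - (\<delta>\<^sup>2 / 2)"
proof (rule LIMSEQ_I, goal_cases)
  case (1 \<epsilon>)
  then have e: "0 < \<epsilon> / 2" by simp
  have "\<forall>\<^sub>F n in sequentially. norm (ln (miss_prob n) / speed n - - (\<delta>\<^sup>2 / 2)) < \<epsilon>"
    using miss_prob_le[OF e] miss_prob_ge[OF e] speed_ge[of 1]
  proof eventually_elim
    case (elim n)
    \<comment> \<open>The lower bound also excludes probability zero, at which \<open>ln\<close>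
      would not be the logarithm meant.\<close>
    have pos: "0 < miss_prob n" using elim(2) exp_gt_zero[of "- (speed n * (\<delta>\<^sup>2 / 2 + \<epsilon> / 2))"] by linarith
    have up: "ln (miss_prob n) \<le> - (speed n * (\<delta>\<^sup>2 / 2 - \<epsilon> / 2))"
      using elim(1) pos by (metis ln_exp ln_le_cancel_iff exp_gt_zero)
    have low: "- (speed n * (\<delta>\<^sup>2 / 2 + \<epsilon> / 2)) \<le> ln (miss_prob n)"
      using elim(2) pos by (metis ln_exp ln_le_cancel_iff exp_gt_zero)
    have cancel: "- (speed n * y) / speed n = - y" for y using elim(3) by simp
    have "0 \<le> speed n" using elim(3) by simp
    from divide_right_mono[OF up this] divide_right_mono[OF low this]
    have "ln (miss_prob n) / speed n \<le> - (\<delta>\<^sup>2 / 2 - \<epsilon> / 2)" "- (\<delta>\<^sup>2 / 2 + \<epsilon> / 2) \<le> ln (miss_prob n) / speed n"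
      unfolding cancel .
    then show ?case using e by (simp add: abs_less_iff)
  qed
  then show ?case by (simp add: eventually_sequentially)
qed

section \<open>Summability and almost sure coverage\<close>

lemma speed_ge_ln_n: "\<forall>\<^sub>F n in sequentially. Z * ln (real n) \<le> speed n"
proof -
  let ?d = "real (CARD('n) + 4)"
  have "(\<lambda>n. ln (real n) / real n powr (1/2)) \<longlonglongrightarrow> 0"
    by (rule lim_ln_over_power) simp
  then have "(\<lambda>n. \<bar>Z\<bar> * (ln (real n) / real n powr (1/2))) \<longlonglongrightarrow> \<bar>Z\<bar> * 0"
    by (intro tendsto_intros)
  then have lnn: "\<forall>\<^sub>F n in sequentially. \<bar>Z\<bar> * (ln (real n) / real n powr (1/2)) < 1"
    by (rule order_tendstoD) simp
  show ?thesis using lnn speed_ge_ln[of "2 * ?d * \<bar>Z\<bar>"] basic_eventually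
  proof eventually_elim
    case (elim n)
    then have n: "1 \<le> n" and v0: "0 < v n" and r: "0 < hs n" by auto
    have n0: "0 < real n" using n by simp
    have Zle: "Z * ln (real n) \<le> \<bar>Z\<bar> * ln (real n)" using n by (intro mult_right_mono) auto
    show ?case
    \<comment> \<open>For large bandwidths v^2 hs^4 \<le> 1 gives speed \<ge> n hs^(d+4) \<ge> sqrt
      n. For small ones ln n is at most 2 (d + 4) ln (1 / hs), which \<open>rate1\<close>
      controls.\<close>
    proof (cases "real n powr (- (1/2)) \<le> hs n ^ (CARD('n) + 4)")
      case True
      have "(v n * (hs n)\<^sup>2)\<^sup>2 \<le> 1" using elim v0 r by (intro power_le_one) auto
      then have "(v n)\<^sup>2 * hs n ^ 4 \<le> 1" by (simp add: power_mult_distrib flip: power_mult)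
      then have "real n * hs n ^ CARD('n) * ((v n)\<^sup>2 * hs n ^ 4) \<le> real n * hs n ^ CARD('n) * 1"
        using r by (intro mult_left_mono) auto
      then have "real n * hs n ^ (CARD('n) + 4) \<le> speed n"
        using v0 by (simp add: speed_def le_divide_eq power_add mult_ac)
      moreover have "real n * real n powr (- (1/2)) \<le> real n * hs n ^ (CARD('n) + 4)"
        using True by (intro mult_left_mono) auto
      moreover have "real n * real n powr (- (1/2)) = real n powr (1/2)"
        using n0 powr_add[of "real n" 1 "- (1/2)"] by simp
      moreover have "\<bar>Z\<bar> * ln (real n) \<le> real n powr (1/2)"
        using elim(1) n0 by (simp add: field_simps)
      ultimately show ?thesis using Zle by linarith
    next
      case False
      then have "ln (hs n ^ (CARD('n) + 4)) < ln (real n powr (- (1/2)))"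
        using r n0 by (subst ln_less_cancel_iff) auto
      then have "?d * ln (hs n) < - (1/2) * ln (real n)"
        using r n0 by (simp add: ln_realpow ln_powr)
      moreover have inv: "ln (1 / hs n) = - ln (hs n)" using r by (simp add: ln_div)
      ultimately have "ln (real n) \<le> 2 * ?d * ln (1 / hs n)"
        unfolding inv by linarith
      then have "\<bar>Z\<bar> * ln (real n) \<le> \<bar>Z\<bar> * (2 * ?d * ln (1 / hs n))" by (intro mult_left_mono) auto
      then show ?thesis using Zle elim(2) by (simp add: mult_ac)
    qed
  qed
qed

lemma summable_miss_prob: "summable miss_prob"
proof (rule summable_comparison_test_ev)
  have "0 < \<delta>\<^sup>2 / 4" using \<delta>_pos by simp
  \<comment> \<open>With \<epsilon> = \<delta>^2 / 4 the exponent is speed times \<delta>^2 / 4, so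
    speed \<ge> (8 / \<delta>^2) ln n yields the summable bound n^(-2).\<close>
  from miss_prob_le[OF this] speed_ge_ln_n[of "8 / \<delta>\<^sup>2"] eventually_ge_at_top[of 1]
  show "\<forall>\<^sub>F n in sequentially. norm (miss_prob n) \<le> inverse (real n ^ 2)"
  proof eventually_elim
    case (elim n)
    have "2 * ln (real n) \<le> speed n * (\<delta>\<^sup>2 / 2 - \<delta>\<^sup>2 / 4)"
      using elim(2) \<delta>_pos by (simp add: field_simps)
    then have "exp (- (speed n * (\<delta>\<^sup>2 / 2 - \<delta>\<^sup>2 / 4))) \<le> exp (- (2 * ln (real n)))" by simp
    also have "\<dots> = inverse (real n ^ 2)"
      using elim(3) exp_of_nat_mult[of 2 "ln (real n)"] by (simp add: exp_minus)
    finally show ?case using elim(1) by simp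
  qed
qed (rule inverse_power_summable, simp)

lemma eventually_not_miss: "AE \<omega> in M. \<forall>\<^sub>F n in sequentially. \<omega> \<in> space M - miss (hs n) (h n) (v n) \<delta> C n"
  by (rule borel_cantelli_AE1) (use summable_miss_prob in \<open>auto simp: emeasure_eq_measure\<close>)

end

theorem theorem2:
  fixes M :: "'w measure"
    and X :: "nat \<Rightarrow> 'w \<Rightarrow> real ^ 'n"
    and f K :: "real ^ 'n \<Rightarrow> real"
    and gradf :: "real ^ 'n \<Rightarrow> real ^ 'n"
    and D2f :: "real ^ 'n \<Rightarrow> ((real ^ 'n) \<Rightarrow>\<^sub>L (real ^ 'n))"
    and h hs v :: "nat \<Rightarrow> real"
    and C :: "(real ^ 'n) set"
    and \<delta> :: real
  assumes "prob_space M"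
    and indep: "prob_space.indep_vars M (\<lambda>_. borel) X {1..}"
    and density: "\<And>j. 1 \<le> j \<Longrightarrow> distributed M lborel (X j) (\<lambda>x. ennreal (f x))"
    and f_nonneg: "\<And>x. 0 \<le> f x"
    and f_bounded: "bounded (range f)"
    and h_pos: "\<And>n. 1 \<le> n \<Longrightarrow> 0 < h n" and h_lim: "h \<longlonglongrightarrow> 0"
    and hs_pos: "\<And>n. 1 \<le> n \<Longrightarrow> 0 < hs n" and hs_lim: "hs \<longlonglongrightarrow> 0"
    and v_pos: "\<And>n. 1 \<le> n \<Longrightarrow> 0 < v n" and v_lim: "filterlim v at_top sequentially"
    and K_bounded: "bounded (range K)"
    and K_nonneg: "\<And>z. 0 \<le> K z"
    and K_integral: "has_bochner_integral lborel K 1"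
    and K_infinity: "(K \<longlongrightarrow> 0) at_infinity"
    and K_centred: "\<And>j. has_bochner_integral lborel (\<lambda>z. z $ j * K z) 0"
    and K_second_moment: "integrable lborel (\<lambda>z. (norm z)\<^sup>2 * \<bar>K z\<bar>)"
    and K_holder: "holder_continuous K"
    and K_covering: "covering_number_condition K"
    and f_grad: "\<And>x. GDERIV f x :> gradf x"
    and f_hess: "\<And>x. (gradf has_derivative blinfun_apply (D2f x)) (at x)"
    and grad_bounded: "bounded (range gradf)"
    and hess_bounded: "bounded (range D2f)"
    and C: "C \<noteq> {}" "compact C" "\<exists>c>0. \<forall>x\<in>C. c \<le> f x"
    and rate1: "filterlim (\<lambda>n. real n * hs n ^ CARD('n) / ((v n)\<^sup>2 * ln (1 / hs n)))
                  at_top sequentially"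
    and rate2: "(\<lambda>n. v n * (hs n)\<^sup>2) \<longlonglongrightarrow> 0"
    and rate3: "filterlim (\<lambda>n. (v n)\<^sup>2 * h n ^ CARD('n) / hs n ^ CARD('n))
                  at_top sequentially"
    and "0 < \<delta>"
  defines "fn \<equiv> \<lambda>n \<omega>. kernel_estimator K (h n) (\<lambda>j. X j \<omega>) n"
    and "fns \<equiv> \<lambda>n \<omega>. kernel_estimator K (hs n) (\<lambda>j. X j \<omega>) n"
    and "\<kappa> \<equiv> kernel_kappa K"
  shows "(\<lambda>n. (v n)\<^sup>2 / (real n * hs n ^ CARD('n)) *
            ln (measure M {\<omega> \<in> space M. \<exists>x\<in>C.
                  f x \<notin> {fns n \<omega> x - \<delta> * (sqrt (fn n \<omega> x * \<kappa>) / v n) ..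
                          fns n \<omega> x + \<delta> * (sqrt (fn n \<omega> x * \<kappa>) / v n)}}))
           \<longlonglongrightarrow> - (\<delta>\<^sup>2 / 2)
         \<and> asymptotic_as_confidence_regions M
             (\<lambda>n \<omega>. {g. \<forall>x\<in>C. \<bar>g x - fns n \<omega> x\<bar> \<le> \<delta> * (sqrt (fn n \<omega> x * \<kappa>) / v n)}) f"
proof -
  obtain F where F: "\<And>x. norm (f x) \<le> F" using f_bounded unfolding bounded_iff by auto
  obtain B where B: "0 < B" "\<And>z. norm (K z) \<le> B" using K_bounded unfolding bounded_pos by auto
  obtain G where G: "\<And>x. norm (gradf x) \<le> G" using grad_bounded unfolding bounded_iff by auto
  obtain H where H: "\<And>x. norm (D2f x) \<le> H" using hess_bounded unfolding bounded_iff by auto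
  obtain \<alpha> L where \<alpha>: "0 < \<alpha>" "0 \<le> L" "\<And>x y. dist (K x) (K y) \<le> L * dist x y powr \<alpha>"
    using K_holder unfolding holder_continuous_def by blast
  obtain c where c: "0 < c" "\<And>x. x \<in> C \<Longrightarrow> c \<le> f x" using C(3) by blast
  have K_moment: "integrable lborel (\<lambda>z. (norm z)\<^sup>2 * K z)"
    using K_second_moment K_nonneg by simp
  interpret kernel_rates M X f K gradf B F G H L \<alpha> h hs v C c \<delta>
    unfolding kernel_rates_def kernel_sample_def iid_sample_def iid_sample_axioms_def
      kernel_sample_axioms_def kernel_rates_axioms_def
  proof (intro conjI allI impI)
    show "f x \<le> F" for x using F[of x] by simp
    show "K z \<le> B" for z using B(2)[of z] by simp
    show "\<bar>f x - f y\<bar> \<le> G * norm (x - y)" for x y by (rule gradient_Lipschitz_bound[OF f_grad G])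
    show "\<bar>f (x + u) - f x - gradf x \<bullet> u\<bar> \<le> H * (norm u)\<^sup>2" for x u
      by (rule gradient_Taylor_bound[OF f_grad f_hess H])
    show "\<bar>K x - K y\<bar> \<le> L * norm (x - y) powr \<alpha>" for x y
      using \<alpha>(3)[of x y] by (simp add: dist_norm)
    show "0 \<le> G" by (rule order_trans[OF norm_ge_zero G])
    show "0 \<le> H" by (rule order_trans[OF norm_ge_zero H])
    show "bounded C" using C(2) by (rule compact_imp_bounded)
  qed (use assms(1) indep density f_nonneg h_pos h_lim hs_pos hs_lim v_pos v_lim K_nonneg K_integral
      K_centred K_moment C(1) c rate1 rate2 rate3 \<open>0 < \<delta>\<close> B(1) \<alpha> in \<open>auto\<close>)
  have event: "{\<omega> \<in> space M. \<exists>x\<in>C.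
                  f x \<notin> {fns n \<omega> x - \<delta> * (sqrt (fn n \<omega> x * \<kappa>) / v n) ..
                          fns n \<omega> x + \<delta> * (sqrt (fn n \<omega> x * \<kappa>) / v n)}} = miss (hs n) (h n) (v n) \<delta> C n" for n
  proof -
    have "u \<notin> {a - b..a + b} \<longleftrightarrow> b < \<bar>u - a\<bar>" for u a b :: real by auto
    then show ?thesis unfolding miss_def fn_def fns_def \<kappa>_def by (simp only:)
  qed
  \<comment> \<open>The confidence statement asks for a measurable set of measure 1; the complement
    of a measurable null set covering the exceptional outcomes is one.\<close>
  obtain N where N: "{\<omega> \<in> space M. \<not> (\<forall>\<^sub>F n in sequentially. \<omega> \<in> space M - miss (hs n) (h n) (v n) \<delta> C n)} \<subseteq> N"
    "emeasure M N = 0" "N \<in> sets M"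
    by (rule AE_E[OF eventually_not_miss])
  have "asymptotic_as_confidence_regions M
             (\<lambda>n \<omega>. {g. \<forall>x\<in>C. \<bar>g x - fns n \<omega> x\<bar> \<le> \<delta> * (sqrt (fn n \<omega> x * \<kappa>) / v n)}) f"
    unfolding asymptotic_as_confidence_regions_def
  proof (intro bexI[of _ "space M - N"] conjI ballI)
    show "space M - N \<in> sets M" using N(3) by auto
    show "prob (space M - N) = 1" using N by (subst prob_compl) (auto simp: measure_def)
    fix \<omega> assume "\<omega> \<in> space M - N"
    then have "\<forall>\<^sub>F n in sequentially. \<omega> \<in> space M - miss (hs n) (h n) (v n) \<delta> C n" using N(1) by blast
    then show "\<exists>N. \<forall>n\<ge>N. f \<in> {g. \<forall>x\<in>C. \<bar>g x - fns n \<omega> x\<bar> \<le> \<delta> * (sqrt (fn n \<omega> x * \<kappa>) / v n)}"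
      unfolding eventually_sequentially miss_def fn_def fns_def \<kappa>_def by (fastforce simp: not_less)
  qed
  moreover have "(\<lambda>n. (v n)\<^sup>2 / (real n * hs n ^ CARD('n)) * ln (miss_prob n)) \<longlonglongrightarrow> - (\<delta>\<^sup>2 / 2)"
    using ln_miss_prob_lim by (simp add: speed_def mult.commute)
  ultimately show ?thesis unfolding event by blast
qed

end
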